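(* Let $X$ be a sequentially complete Hausdorff topological vector space, $\mathcal H$ a $\sigma$-algebra of subsets of a nonempty set $\Omega$, and $\mu:\mathcal H\to X$ a convexly bounded vector measure. Let $f\in L^0(\mu)$ be Bartle–Dunford–Schwartz (BDS) integrable. Then $f$ is $S^*$-partition integrable and $$\int_A^{S^*}f\,d\mu=\int_A^{(BDS)}f\,d\mu\qquad\text{for each }A\in\mathcal H .$$
   Context: A vector measure is a $\sigma$-additive set function $\mu:\mathcal H\to X$; it is convexly bounded if the convex hull of its range is bounded in $X$. A set $A\in\mathcal H$ is $\mu$-null if $\mu(B)=0$ for every $B\in\mathcal H$ with $B\subseteq A$; "$\mu$-a.e." means outside a $\mu$-null set. A function $f:\Omega\to\mathbb R$ is $\mu$-measurable if it equals, outside a $\mu$-null set, an $\mathcal H$-measurable (Borel) function; $L^0(\mu)$ is the space of $\mu$-measurable functions modulo equality $\mu$-a.e. For a simple function $s=\sum_{i=1}^ns_i\mathbf 1_{A_i}$ ($s_i\in\mathbb R$, $A_i\in\mathcal H$), $\int_As\,d\mu=\sum_is_i\mu(A\cap A_i)$. $f\in L^0(\mu)$ is BDS integrable if there is a sequence $\{f_n\}$ of simple functions with $f_n\to f$ $\mu$-a.e. such that $\lim_n\int_Af_n\,d\mu$ exists in $X$ for each $A\in\mathcal H$; then $\int_A^{(BDS)}f\,d\mu=\lim_n\int_Af_n\,d\mu$. $S^*$-partition integral on $A\in\mathcal H$: let $\mathcal P(A)$ be the set of countable partitions of $A$ into nonempty sets of $\mathcal H$, ordered by refinement ($P\le Q$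 iff every member of $Q$ is contained in a member of $P$). A choice function $\delta$ selects a point $\delta_\alpha\in\alpha$ for every nonempty $\alpha\subseteq\Omega$. $f:\Omega\to\mathbb R$ is $S^*$-partition integrable on $A$ with integral $\int_A^{S^*}f\,d\mu=z\in X$ if there is $P_*\in\mathcal P(A)$ such that for all $P\ge P_*$ and all $\delta$ the series $\sum_{\alpha\in P}f(\delta_\alpha)\mu(\alpha)$ is unconditionally convergent in $X$ (the net of finite partial sums, ordered by inclusion of finite subfamilies, converges), and for every neighborhood $U$ of $0$ in $X$ there is $P_0\in\mathcal P(A)$ with $\sum_{\alpha\in P}f(\delta_\alpha)\mu(\alpha)-z\in U$ for all $P\ge P_0$ and all choice functions $\delta$. $f$ is $S^*$-partition integrable if it is so on every $A\in\mathcal H$. *)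

theory Defs
  imports "HOL-Analysis.Analysis"
begin

text \<open>Hausdorff real topological vector spaces; no local convexity and no metrizability is
  assumed. The axiom is joint continuity of scalar multiplication.\<close>

class hausdorff_tvs = real_vector + topological_ab_group_add + t2_space +
  assumes tendsto_scaleR_Pair:
    "LIM x (nhds r \<times>\<^sub>F nhds a). fst x *\<^sub>R snd x :> nhds (r *\<^sub>R a)"

definition tvs_Cauchy :: "(nat \<Rightarrow> 'x::hausdorff_tvs) \<Rightarrow> bool" where
  "tvs_Cauchy x \<longleftrightarrow> (\<forall>U. open U \<and> 0 \<in> U \<longrightarrow> (\<exists>N. \<forall>m\<ge>N. \<forall>n\<ge>N. x m - x n \<in> U))"

definition sequentially_complete :: "'x::hausdorff_tvs itself \<Rightarrow> bool" where
  "sequentially_complete _ \<longleftrightarrow> (\<forall>x :: nat \<Rightarrow> 'x. tvs_Cauchy x \<longrightarrow> convergent x)"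

definition tvs_bounded :: "'x::hausdorff_tvs set \<Rightarrow> bool" where
  "tvs_bounded B \<longleftrightarrow>
     (\<forall>U. open U \<and> 0 \<in> U \<longrightarrow> (\<exists>s>0. \<forall>t>s. B \<subseteq> (\<lambda>u. t *\<^sub>R u) ` U))"


subsection \<open>Vector measures\<close>

definition vector_measure :: "'a set set \<Rightarrow> ('a set \<Rightarrow> 'x::hausdorff_tvs) \<Rightarrow> bool" where
  "vector_measure H \<mu> \<longleftrightarrow>
     (\<forall>A :: nat \<Rightarrow> 'a set. range A \<subseteq> H \<and> disjoint_family A
        \<longrightarrow> (\<lambda>n. \<mu> (A n)) sums \<mu> (\<Union>n. A n))"

definition convexly_bounded :: "'a set set \<Rightarrow> ('a set \<Rightarrow> 'x::hausdorff_tvs) \<Rightarrow> bool" where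
  "convexly_bounded H \<mu> \<longleftrightarrow> tvs_bounded (convex hull (\<mu> ` H))"

definition vm_null :: "'a set set \<Rightarrow> ('a set \<Rightarrow> 'x::hausdorff_tvs) \<Rightarrow> 'a set \<Rightarrow> bool" where
  "vm_null H \<mu> A \<longleftrightarrow> A \<in> H \<and> (\<forall>B\<in>H. B \<subseteq> A \<longrightarrow> \<mu> B = 0)"

definition vm_ae ::
  "'a set \<Rightarrow> 'a set set \<Rightarrow> ('a set \<Rightarrow> 'x::hausdorff_tvs) \<Rightarrow> ('a \<Rightarrow> bool) \<Rightarrow> bool" where
  "vm_ae \<Omega> H \<mu> P \<longleftrightarrow> (\<exists>N. vm_null H \<mu> N \<and> (\<forall>x\<in>\<Omega> - N. P x))"

text \<open>Functions on \<open>\<Omega>\<close> are represented by total functions whose values off \<open>\<Omega>\<close> play no role, and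
  elements of \<open>L\<^sup>0(\<mu>)\<close> by their representatives.\<close>

definition vm_measurable ::
  "'a set \<Rightarrow> 'a set set \<Rightarrow> ('a set \<Rightarrow> 'x::hausdorff_tvs) \<Rightarrow> ('a \<Rightarrow> real) \<Rightarrow> bool" where
  "vm_measurable \<Omega> H \<mu> f \<longleftrightarrow>
     (\<exists>g \<in> borel_measurable (sigma \<Omega> H). vm_ae \<Omega> H \<mu> (\<lambda>x. f x = g x))"


subsection \<open>The Bartle--Dunford--Schwartz integral\<close>

text \<open>The integral of a simple function over \<open>A\<close>, computed from its canonical representation;
  \<open>vm_simple_integral_eq\<close> below shows that every representation gives the same value.\<close>

definition vm_simple_integral ::
  "'a set \<Rightarrow> ('a set \<Rightarrow> 'x::hausdorff_tvs) \<Rightarrow> 'a set \<Rightarrow> ('a \<Rightarrow> real) \<Rightarrow> 'x" where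
  "vm_simple_integral \<Omega> \<mu> A s = (\<Sum>c\<in>s ` \<Omega>. c *\<^sub>R \<mu> (A \<inter> (s -` {c} \<inter> \<Omega>)))"

definition bds_sequence ::
  "'a set \<Rightarrow> 'a set set \<Rightarrow> ('a set \<Rightarrow> 'x::hausdorff_tvs) \<Rightarrow> ('a \<Rightarrow> real) \<Rightarrow> (nat \<Rightarrow> 'a \<Rightarrow> real) \<Rightarrow> bool"
  where
  "bds_sequence \<Omega> H \<mu> f s \<longleftrightarrow>
     (\<forall>n. simple_function (sigma \<Omega> H) (s n)) \<and>
     vm_ae \<Omega> H \<mu> (\<lambda>x. (\<lambda>n. s n x) \<longlonglongrightarrow> f x) \<and>
     (\<forall>A\<in>H. convergent (\<lambda>n. vm_simple_integral \<Omega> \<mu> A (s n)))"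

definition bds_integrable ::
  "'a set \<Rightarrow> 'a set set \<Rightarrow> ('a set \<Rightarrow> 'x::hausdorff_tvs) \<Rightarrow> ('a \<Rightarrow> real) \<Rightarrow> bool" where
  "bds_integrable \<Omega> H \<mu> f \<longleftrightarrow> vm_measurable \<Omega> H \<mu> f \<and> (\<exists>s. bds_sequence \<Omega> H \<mu> f s)"

text \<open>The value of the integral is a relation, so that its independence of the approximating
  sequence is not presupposed.\<close>

definition has_bds_integral ::
  "'a set \<Rightarrow> 'a set set \<Rightarrow> ('a set \<Rightarrow> 'x::hausdorff_tvs) \<Rightarrow> 'a set \<Rightarrow> ('a \<Rightarrow> real) \<Rightarrow> 'x \<Rightarrow> bool" where
  "has_bds_integral \<Omega> H \<mu> A f z \<longleftrightarrow>
     (\<exists>s. bds_sequence \<Omega> H \<mu> f s \<and> (\<lambda>n. vm_simple_integral \<Omega> \<mu> A (s n)) \<longlonglongrightarrow> z)"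


subsection \<open>The \<open>S\<^sup>*\<close>-partition integral\<close>

definition countable_partitions :: "'a set set \<Rightarrow> 'a set \<Rightarrow> 'a set set set" where
  "countable_partitions H A = {P. partition_on A P \<and> P \<subseteq> H \<and> countable P}"

definition choice_function :: "'a set \<Rightarrow> ('a set \<Rightarrow> 'a) \<Rightarrow> bool" where
  "choice_function \<Omega> \<delta> \<longleftrightarrow> (\<forall>\<alpha>. \<alpha> \<noteq> {} \<and> \<alpha> \<subseteq> \<Omega> \<longrightarrow> \<delta> \<alpha> \<in> \<alpha>)"

text \<open>In the library, \<open>refines A P Q\<close> means that \<open>P\<close> is finer than \<open>Q\<close>. Both \<open>summable_on\<close> and
  \<open>\<Sum>\<^sub>\<infinity>\<close> refer to the net of finite partial sums, that is, to unconditional convergence. Summability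
  is required of the partitions finer than some \<open>P\<^sub>1\<close>; as two countable partitions have a common
  refinement, \<open>P\<^sub>0\<close> may always be taken finer than \<open>P\<^sub>1\<close>, so the default value of \<open>\<Sum>\<^sub>\<infinity>\<close> for
  non-summable families has no influence.\<close>

definition has_sstar_integral ::
  "'a set \<Rightarrow> 'a set set \<Rightarrow> ('a set \<Rightarrow> 'x::hausdorff_tvs) \<Rightarrow> 'a set \<Rightarrow> ('a \<Rightarrow> real) \<Rightarrow> 'x \<Rightarrow> bool" where
  "has_sstar_integral \<Omega> H \<mu> A f z \<longleftrightarrow>
     (\<exists>P\<^sub>1 \<in> countable_partitions H A.
        \<forall>P \<in> countable_partitions H A. \<forall>\<delta>. refines A P P\<^sub>1 \<and> choice_function \<Omega> \<delta> \<longrightarrow>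
          (\<lambda>\<alpha>. f (\<delta> \<alpha>) *\<^sub>R \<mu> \<alpha>) summable_on P) \<and>
     (\<forall>U. open U \<and> 0 \<in> U \<longrightarrow>
        (\<exists>P\<^sub>0 \<in> countable_partitions H A.
           \<forall>P \<in> countable_partitions H A. \<forall>\<delta>. refines A P P\<^sub>0 \<and> choice_function \<Omega> \<delta> \<longrightarrow>
             (\<Sum>\<^sub>\<infinity>\<alpha>\<in>P. f (\<delta> \<alpha>) *\<^sub>R \<mu> \<alpha>) - z \<in> U))"

definition sstar_integrable ::
  "'a set \<Rightarrow> 'a set set \<Rightarrow> ('a set \<Rightarrow> 'x::hausdorff_tvs) \<Rightarrow> ('a \<Rightarrow> real) \<Rightarrow> bool" where
  "sstar_integrable \<Omega> H \<mu> f \<longleftrightarrow> (\<forall>A\<in>H. \<exists>z. has_sstar_integral \<Omega> H \<mu> A f z)"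


subsection \<open>Well-definedness\<close>

lemma vector_measure_empty:
  assumes "sigma_algebra \<Omega> H" "vector_measure H \<mu>"
  shows "\<mu> {} = (0 :: 'x::hausdorff_tvs)"
proof -
  interpret sigma_algebra \<Omega> H by fact
  have s: "(\<lambda>n::nat. \<mu> {}) sums \<mu> {}"
    using assms(2)[unfolded vector_measure_def, rule_format, of "\<lambda>_. {}"]
    by (auto simp: disjoint_family_on_def)
  have "(\<lambda>n. (\<Sum>i<Suc n. \<mu> {}) - (\<Sum>i<n. \<mu> {})) \<longlonglongrightarrow> \<mu> {} - \<mu> {}"
    using s unfolding sums_def by (intro tendsto_diff LIMSEQ_Suc)
  then have "(\<lambda>n::nat. \<mu> {}) \<longlonglongrightarrow> 0" by simp
  then show ?thesis by (metis LIMSEQ_unique tendsto_const)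
qed

lemma vector_measure_Un:
  assumes "sigma_algebra \<Omega> H" "vector_measure H \<mu>" "A \<in> H" "B \<in> H" "A \<inter> B = {}"
  shows "\<mu> (A \<union> B) = \<mu> A + (\<mu> B :: 'x::hausdorff_tvs)"
proof -
  interpret sigma_algebra \<Omega> H by fact
  have "(\<lambda>n. \<mu> (binaryset A B n)) sums \<mu> (\<Union>n. binaryset A B n)"
  proof (rule assms(2)[unfolded vector_measure_def, rule_format], intro conjI)
    show "range (binaryset A B) \<subseteq> H" using assms(3,4) by (simp add: range_binaryset_eq)
    show "disjoint_family (binaryset A B)"
      using assms(5) by (auto simp: disjoint_family_on_def binaryset_def)
  qed
  moreover have "(\<lambda>n. \<mu> (binaryset A B n)) sums (\<mu> A + \<mu> B)"
    by (rule binaryset_sums) (rule vector_measure_empty[OF assms(1,2)])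
  ultimately show ?thesis by (metis UN_binaryset_eq sums_unique2)
qed

lemma vector_measure_finite_UN:
  assumes "sigma_algebra \<Omega> H" "vector_measure H \<mu>" "finite J"
    and "\<And>j. j \<in> J \<Longrightarrow> F j \<in> H" "disjoint_family_on F J"
  shows "\<mu> (\<Union>j\<in>J. F j) = (\<Sum>j\<in>J. \<mu> (F j) :: 'x::hausdorff_tvs)"
  using assms(3-5)
proof (induction J rule: finite_induct)
  case empty
  then show ?case using vector_measure_empty[OF assms(1,2)] by simp
next
  case (insert j J)
  interpret sigma_algebra \<Omega> H by fact
  have "F j \<inter> (\<Union>j\<in>J. F j) = {}"
    using insert.prems(2) insert.hyps(2) by (force simp: disjoint_family_on_def)
  then have "\<mu> (F j \<union> (\<Union>j\<in>J. F j)) = \<mu> (F j) + \<mu> (\<Union>j\<in>J. F j)"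
    using insert by (intro vector_measure_Un[OF assms(1,2)]) auto
  moreover have "\<mu> (\<Union>j\<in>J. F j) = (\<Sum>j\<in>J. \<mu> (F j))"
    using insert by (intro insert.IH) (auto simp: disjoint_family_on_def)
  ultimately show ?case using insert.hyps by simp
qed

lemma vm_simple_integral_eq:
  fixes \<mu> :: "'a set \<Rightarrow> 'x::hausdorff_tvs" and B :: "'i \<Rightarrow> 'a set"
  assumes "sigma_algebra \<Omega> H" "vector_measure H \<mu>" "finite I" "\<And>i. i \<in> I \<Longrightarrow> B i \<in> H"
    and s: "\<And>x. x \<in> \<Omega> \<Longrightarrow> s x = (\<Sum>i\<in>I. c i * indicator (B i) x)" and A: "A \<in> H"
  shows "vm_simple_integral \<Omega> \<mu> A s = (\<Sum>i\<in>I. c i *\<^sub>R \<mu> (A \<inter> B i))"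
proof -
  interpret sigma_algebra \<Omega> H by fact
  note fin = \<open>finite I\<close>
  define E where "E J = {x\<in>\<Omega>. {i\<in>I. x \<in> B i} = J}" for J
  define v where "v J = (\<Sum>i\<in>J. c i)" for J
  have AS: "A \<subseteq> \<Omega>" using A sets_into_space by auto
  have BH: "B i \<in> H" if "i \<in> I" for i using assms(4) that .
  have EH: "E J \<in> H" if "J \<subseteq> I" for J
  proof -
    have "E J = {x\<in>\<Omega>. \<forall>i\<in>I. (x \<in> B i) = (i \<in> J)}" using that by (auto simp: E_def)
    also have "\<dots> \<in> H"
    proof (rule sets_Collect_finite_All[OF _ fin])
      fix i assume "i \<in> I"
      then have "{x\<in>\<Omega>. (x \<in> B i) = (i \<in> J)} = (if i \<in> J then B i else \<Omega> - B i)"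
        using BH[of i] sets_into_space by auto
      then show "{x\<in>\<Omega>. (x \<in> B i) = (i \<in> J)} \<in> H" using BH[OF \<open>i \<in> I\<close>] by auto
    qed
    finally show ?thesis .
  qed
  have sv: "s x = v J" if "x \<in> E J" for x J
  proof -
    have "s x = (\<Sum>i\<in>I. c i * indicator (B i) x)" using that s by (auto simp: E_def)
    also have "\<dots> = (\<Sum>i\<in>{i\<in>I. x \<in> B i}. c i)"
      using fin by (intro sum.mono_neutral_cong_right) (auto simp: indicator_def)
    finally show ?thesis using that by (simp add: E_def v_def)
  qed
  have add: "\<mu> (\<Union>J\<in>K. A \<inter> E J) = (\<Sum>J\<in>K. \<mu> (A \<inter> E J))" if "K \<subseteq> Pow I" for K
  proof (rule vector_measure_finite_UN[OF assms(1,2)])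
    show "finite K" using that fin finite_subset by blast
    show "A \<inter> E J \<in> H" if "J \<in> K" for J using that \<open>K \<subseteq> Pow I\<close> A EH[of J] by blast
    show "disjoint_family_on (\<lambda>J. A \<inter> E J) K" by (auto simp: disjoint_family_on_def E_def)
  qed
  have "(\<Sum>i\<in>I. c i *\<^sub>R \<mu> (A \<inter> B i)) = (\<Sum>i\<in>I. \<Sum>J\<in>{J\<in>Pow I. i \<in> J}. c i *\<^sub>R \<mu> (A \<inter> E J))"
  proof (rule sum.cong[OF refl])
    fix i assume "i \<in> I"
    then have "A \<inter> B i = (\<Union>J\<in>{J\<in>Pow I. i \<in> J}. A \<inter> E J)"
    proof (intro equalityI subsetI)
      fix x assume x: "x \<in> A \<inter> B i"
      then have "x \<in> E {i\<in>I. x \<in> B i}" using AS by (auto simp: E_def)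
      then show "x \<in> (\<Union>J\<in>{J\<in>Pow I. i \<in> J}. A \<inter> E J)"
        using x \<open>i \<in> I\<close> by (intro UN_I[of "{i\<in>I. x \<in> B i}"]) auto
    qed (auto simp: E_def)
    moreover have "\<mu> (\<Union>J\<in>{J\<in>Pow I. i \<in> J}. A \<inter> E J) = (\<Sum>J\<in>{J\<in>Pow I. i \<in> J}. \<mu> (A \<inter> E J))"
      by (rule add) blast
    ultimately show "c i *\<^sub>R \<mu> (A \<inter> B i) = (\<Sum>J\<in>{J\<in>Pow I. i \<in> J}. c i *\<^sub>R \<mu> (A \<inter> E J))"
      by (simp only: scaleR_sum_right)
  qed
  also have "\<dots> = (\<Sum>J\<in>Pow I. \<Sum>i\<in>{i\<in>I. i \<in> J}. c i *\<^sub>R \<mu> (A \<inter> E J))"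
    using fin by (intro sum.swap_restrict) auto
  also have "\<dots> = (\<Sum>J\<in>Pow I. v J *\<^sub>R \<mu> (A \<inter> E J))"
  proof (rule sum.cong[OF refl])
    fix J assume "J \<in> Pow I"
    then have "{i\<in>I. i \<in> J} = J" by auto
    then show "(\<Sum>i\<in>{i\<in>I. i \<in> J}. c i *\<^sub>R \<mu> (A \<inter> E J)) = v J *\<^sub>R \<mu> (A \<inter> E J)"
      by (simp add: v_def scaleR_sum_left)
  qed
  also have "\<dots> = (\<Sum>J\<in>{J\<in>Pow I. v J \<in> s ` \<Omega>}. v J *\<^sub>R \<mu> (A \<inter> E J))"
  proof (rule sum.mono_neutral_right)
    show "\<forall>J\<in>Pow I - {J\<in>Pow I. v J \<in> s ` \<Omega>}. v J *\<^sub>R \<mu> (A \<inter> E J) = 0"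
    proof
      fix J assume "J \<in> Pow I - {J\<in>Pow I. v J \<in> s ` \<Omega>}"
      then have "E J = {}" using sv[of _ J] by (force simp: E_def)
      then show "v J *\<^sub>R \<mu> (A \<inter> E J) = 0" using vector_measure_empty[OF assms(1,2)] by simp
    qed
  qed (use fin in auto)
  also have "\<dots> = (\<Sum>a\<in>s ` \<Omega>. \<Sum>J\<in>{J\<in>{J\<in>Pow I. v J \<in> s ` \<Omega>}. v J = a}. v J *\<^sub>R \<mu> (A \<inter> E J))"
  proof (rule sum.group[symmetric])
    have "s ` \<Omega> \<subseteq> v ` Pow I" using sv by (force simp: E_def)
    then show "finite (s ` \<Omega>)" using fin finite_subset by blast
  qed (use fin in auto)
  also have "\<dots> = vm_simple_integral \<Omega> \<mu> A s"
    unfolding vm_simple_integral_def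
  proof (rule sum.cong[OF refl])
    fix a assume a: "a \<in> s ` \<Omega>"
    let ?K = "{J\<in>{J\<in>Pow I. v J \<in> s ` \<Omega>}. v J = a}"
    have "A \<inter> (s -` {a} \<inter> \<Omega>) = (\<Union>J\<in>?K. A \<inter> E J)"
    proof (intro equalityI subsetI)
      fix x assume x: "x \<in> A \<inter> (s -` {a} \<inter> \<Omega>)"
      then have e: "x \<in> E {i\<in>I. x \<in> B i}" by (auto simp: E_def)
      then show "x \<in> (\<Union>J\<in>?K. A \<inter> E J)"
        using x a sv[OF e] by (intro UN_I[of "{i\<in>I. x \<in> B i}"]) auto
    qed (use sv in \<open>auto simp: E_def\<close>)
    then have "\<mu> (A \<inter> (s -` {a} \<inter> \<Omega>)) = (\<Sum>J\<in>?K. \<mu> (A \<inter> E J))"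
      using add[of ?K] by auto
    then show "(\<Sum>J\<in>?K. v J *\<^sub>R \<mu> (A \<inter> E J)) = a *\<^sub>R \<mu> (A \<inter> (s -` {a} \<inter> \<Omega>))"
      by (simp add: scaleR_sum_right)
  qed
  finally show ?thesis by simp
qed

lemma countable_partitions_common_refinement:
  assumes "sigma_algebra \<Omega> H" "P \<in> countable_partitions H A" "Q \<in> countable_partitions H A"
  obtains R where "R \<in> countable_partitions H A" "refines A R P" "refines A R Q"
proof -
  interpret sigma_algebra \<Omega> H by fact
  define R where "R = (\<lambda>(p, q). p \<inter> q) ` (P \<times> Q) - {{}}"
  have P: "partition_on A P" "P \<subseteq> H" "countable P" and Q: "partition_on A Q" "Q \<subseteq> H" "countable Q"
    using assms(2,3) by (auto simp: countable_partitions_def)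
  have R: "partition_on A R"
  proof (rule partition_onI)
    show "\<Union>R = A"
    proof (intro equalityI subsetI)
      fix x assume "x \<in> A"
      then obtain p q where "p \<in> P" "q \<in> Q" "x \<in> p" "x \<in> q"
        using P(1) Q(1) unfolding partition_on_def by blast
      then show "x \<in> \<Union>R" unfolding R_def by (intro UnionI[of "p \<inter> q"]) auto
    qed (use P(1) in \<open>auto simp: R_def partition_on_def\<close>)
    fix r r' assume "r \<in> R" "r' \<in> R" "r \<noteq> r'"
    then obtain p q p' q' where "p \<in> P" "q \<in> Q" "p' \<in> P" "q' \<in> Q" "r = p \<inter> q" "r' = p' \<inter> q'"
      "p \<noteq> p' \<or> q \<noteq> q'" unfolding R_def by auto
    then show "disjnt r r'"
      using P(1) Q(1) unfolding partition_on_def pairwise_def disjnt_def by blast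
  qed (simp add: R_def)
  have "R \<in> countable_partitions H A"
    using P Q R by (auto simp: countable_partitions_def R_def)
  moreover have "refines A R P" "refines A R Q"
    using P Q R by (auto simp: refines_def R_def)
  ultimately show ?thesis using that by metis
qed

lemma has_sstar_integral_unique:
  fixes \<mu> :: "'a set \<Rightarrow> 'x::hausdorff_tvs"
  assumes "sigma_algebra \<Omega> H" "has_sstar_integral \<Omega> H \<mu> A f y" "has_sstar_integral \<Omega> H \<mu> A f z"
  shows "y = z"
proof (rule ccontr)
  assume "y \<noteq> z"
  from hausdorff[OF this]
  obtain U V where UV: "open U" "open V" "y \<in> U" "z \<in> V" "U \<inter> V = {}"
    by (elim exE conjE)
  have op: "open ((\<lambda>u. u + w) -` W)" if "open W" for w and W :: "'x set"
    by (rule open_vimage[OF that]) (intro continuous_on_add continuous_on_id continuous_on_const)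
  obtain P where P: "P \<in> countable_partitions H A"
    "\<And>R \<delta>. R \<in> countable_partitions H A \<Longrightarrow> refines A R P \<Longrightarrow> choice_function \<Omega> \<delta> \<Longrightarrow>
       (\<Sum>\<^sub>\<infinity>\<alpha>\<in>R. f (\<delta> \<alpha>) *\<^sub>R \<mu> \<alpha>) - y \<in> (\<lambda>u. u + y) -` U"
  proof -
    have "0 \<in> (\<lambda>u. u + y) -` U" using UV(3) by simp
    then show ?thesis
      using assms(2)[unfolded has_sstar_integral_def, THEN conjunct2, rule_format,
          of "(\<lambda>u. u + y) -` U"] op[OF UV(1), of y] that by metis
  qed
  obtain Q where Q: "Q \<in> countable_partitions H A"
    "\<And>R \<delta>. R \<in> countable_partitions H A \<Longrightarrow> refines A R Q \<Longrightarrow> choice_function \<Omega> \<delta> \<Longrightarrow>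
       (\<Sum>\<^sub>\<infinity>\<alpha>\<in>R. f (\<delta> \<alpha>) *\<^sub>R \<mu> \<alpha>) - z \<in> (\<lambda>u. u + z) -` V"
  proof -
    have "0 \<in> (\<lambda>u. u + z) -` V" using UV(4) by simp
    then show ?thesis
      using assms(3)[unfolded has_sstar_integral_def, THEN conjunct2, rule_format,
          of "(\<lambda>u. u + z) -` V"] op[OF UV(2), of z] that by metis
  qed
  obtain R where R: "R \<in> countable_partitions H A" "refines A R P" "refines A R Q"
    using countable_partitions_common_refinement[OF assms(1) P(1) Q(1)] .
  have "choice_function \<Omega> (\<lambda>\<alpha>. SOME x. x \<in> \<alpha>)"
    by (auto simp: choice_function_def some_in_eq)
  then show False
    using P(2)[OF R(1,2)] Q(2)[OF R(1,3)] UV(5) unfolding vimage_def mem_Collect_eq diff_add_cancel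
    by blast
qed

end

theory Submission
  imports Defs
begin

text \<open>
  Let \<open>s n\<close> be the simple functions that approximate \<open>f\<close> off a null set \<open>N\<close>, and let \<open>\<nu> A\<close> be the
  limit of their integrals over \<open>A\<close>. The space need be neither locally convex nor metrizable, and
  there need be no scalar measure that controls \<open>\<mu>\<close>; three facts replace the usual tools.

  First, \<open>\<nu>\<close> is again \<open>\<sigma>\<close>-additive (\<open>nikodym_convergence\<close>). For a disjoint sequence \<open>B\<close>, the
  values on unions of members of \<open>B\<close> are continuous functions on the Cantor space of sets of
  indices, and a Baire category argument, written out as a construction of nested finite patterns,
  makes the pointwise convergence uniform on the unions that avoid finitely many indices.

  Secondly, convex boundedness makes the integral of a simple function small whenever the function
  is uniformly small (\<open>small_simple_integral\<close>), because the integral of a simple function with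
  values in \<open>[0, 1]\<close> is a convex combination of values of \<open>\<mu>\<close>.

  Thirdly, these two facts show that a simple function \<open>h\<close> with \<open>\<bar>f - h\<bar> \<le> \<eta>\<close> on \<open>C - N\<close> has an
  integral over \<open>C\<close> close to \<open>\<nu> C\<close>, uniformly in \<open>C\<close> and \<open>h\<close> (\<open>uniform_approximation\<close>). On the set
  where \<open>\<bar>s n - h\<bar> \<le> 2 * \<eta>\<close> for all \<open>n \<ge> m\<close> the comparison passes to the limit in \<open>n\<close>; these sets
  increase to \<open>C - N\<close> with \<open>m\<close>, so that \<open>\<sigma>\<close>-additivity of \<open>\<nu>\<close> does the rest.

  Now take a partition on whose members outside \<open>N\<close> the function \<open>f\<close> oscillates by at most \<open>\<eta>\<close>. A
  finite partial sum of \<open>f (\<delta> \<alpha>) *\<^sub>R \<mu> \<alpha>\<close> over any refinement is the integral of a step function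
  within \<open>\<eta>\<close> of \<open>f\<close>, hence close to the corresponding partial sum of \<open>\<nu>\<close>. This gives closeness of
  the whole sum to \<open>\<nu> A\<close>. It does not give convergence, since the error bound does not improve for
  partial sums taken farther out. For convergence the difference between the step function and \<open>f\<close> is
  itself approximated by one simple function \<open>r\<close> (\<open>simple_remainder\<close>); it is bounded, so finitely
  many values suffice for any accuracy. The partial sums are then close to those of the vector
  measure \<open>\<lambda>A. \<nu> A + vm_simple_integral \<Omega> \<mu> A r\<close>, whose tails vanish, and sequential completeness
  applies (\<open>partition_sum_summable\<close>).
\<close>

section \<open>Neighbourhoods of zero\<close>

text \<open>By continuity of addition and subtraction, \<open>V + V \<subseteq> U\<close> and \<open>V - V \<subseteq> U\<close> for a small \<open>V\<close>. The
  inclusion of the closure follows: a point \<open>x\<close> of the closure of \<open>V\<close> satisfies \<open>x - y \<in> V\<close> for some \<open>y \<in> V\<close>, whence \<open>x \<in> U\<close>.\<close>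

lemma zero_neighbourhood_arith:
  fixes U :: "'x::topological_ab_group_add set"
  assumes "open U" "0 \<in> U"
  obtains V where "open V" "0 \<in> V" "\<And>x y. x \<in> V \<Longrightarrow> y \<in> V \<Longrightarrow> x + y \<in> U"
    "\<And>x y. x \<in> V \<Longrightarrow> y \<in> V \<Longrightarrow> x - y \<in> U" "closure V \<subseteq> U"
proof -
  let ?S = "((\<lambda>p. fst p + snd p) -` U) \<inter> ((\<lambda>p. fst p - snd p) -` U) :: ('x \<times> 'x) set"
  have "open ?S"
    by (intro open_Int open_vimage assms(1) continuous_on_add continuous_on_diff
        continuous_on_fst continuous_on_snd continuous_on_id)
  moreover have "(0, 0) \<in> ?S" using assms(2) by simp
  ultimately obtain A B where AB: "open A" "open B" "(0, 0) \<in> A \<times> B" "A \<times> B \<subseteq> ?S"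
    by (rule open_prod_elim)
  define V where "V = A \<inter> B"
  have V: "open V" "0 \<in> V" using AB by (auto simp: V_def)
  have p: "x + y \<in> U" and m: "x - y \<in> U" if "x \<in> V" "y \<in> V" for x y
    using AB(4) that by (auto simp: V_def)
  have "closure V \<subseteq> U"
  proof
    fix x assume x: "x \<in> closure V"
    have "open ((\<lambda>y. x - y) -` V)"
      by (intro open_vimage V continuous_on_diff continuous_on_const continuous_on_id)
    moreover have "x \<in> (\<lambda>y. x - y) -` V" using V by simp
    ultimately obtain y where "y \<in> V" "x - y \<in> V"
      using x open_Int_closure_eq_empty[of "(\<lambda>y. x - y) -` V" V] by blast
    then show "x \<in> U" using p[of "x - y" y] by simp
  qed
  then show ?thesis using that[of V] V p m by blast
qed

lemma tendsto_iff_zero_neighbourhoods: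
  fixes z :: "'x::topological_ab_group_add"
  shows "(f \<longlongrightarrow> z) F \<longleftrightarrow> (\<forall>U. open U \<and> 0 \<in> U \<longrightarrow> (\<forall>\<^sub>F x in F. f x - z \<in> U))"
  using tendsto_diff[of f z F "\<lambda>_. z" z] tendsto_add[of "\<lambda>x. f x - z" 0 F "\<lambda>_. z" z]
  unfolding topological_tendstoI tendsto_def[of "\<lambda>x. f x - z"] by auto

lemma tvs_Cauchy_if_LIMSEQ:
  assumes "x \<longlonglongrightarrow> z"
  shows "tvs_Cauchy x"
  unfolding tvs_Cauchy_def
proof (intro allI impI)
  fix U :: "'a set" assume "open U \<and> 0 \<in> U"
  then obtain V where V: "open V" "0 \<in> V" "\<And>x y. x \<in> V \<Longrightarrow> y \<in> V \<Longrightarrow> x - y \<in> U"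
    using zero_neighbourhood_arith[of U] by metis
  obtain N where N: "\<And>n. n \<ge> N \<Longrightarrow> x n - z \<in> V"
    using assms V unfolding tendsto_iff_zero_neighbourhoods eventually_sequentially by blast
  have "x m - x n \<in> U" if "m \<ge> N" "n \<ge> N" for m n
    using V(3)[OF N[OF that(1)] N[OF that(2)]] by simp
  then show "\<exists>N. \<forall>m\<ge>N. \<forall>n\<ge>N. x m - x n \<in> U" by blast
qed

lemma tendsto_scaleR_tvs:
  fixes a :: "'x::hausdorff_tvs"
  assumes "(g \<longlongrightarrow> a) F"
  shows "((\<lambda>x. c *\<^sub>R g x) \<longlongrightarrow> c *\<^sub>R a) F"
  using filterlim_compose[OF tendsto_scaleR_Pair filterlim_Pair[OF tendsto_const assms]] by simp


section \<open>Vector measures\<close>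

lemma vector_measureD:
  "vector_measure H \<mu> \<Longrightarrow> range A \<subseteq> H \<Longrightarrow> disjoint_family A \<Longrightarrow> (\<lambda>n. \<mu> (A n)) sums \<mu> (\<Union>n. A n)"
  unfolding vector_measure_def by blast

lemma vector_measure_diff:
  assumes "vector_measure H \<mu>" "vector_measure H \<nu>"
  shows "vector_measure H (\<lambda>A. \<mu> A - \<nu> A)"
  using assms unfolding vector_measure_def sums_def
  by (auto simp: sum_subtractf intro!: tendsto_diff)

lemma vector_measure_add:
  assumes "vector_measure H \<mu>" "vector_measure H \<nu>"
  shows "vector_measure H (\<lambda>A. \<mu> A + \<nu> A)"
  using assms unfolding vector_measure_def sums_def
  by (auto simp: sum.distrib intro!: tendsto_add)

lemma vector_measure_disjoint_tendsto_0:
  assumes "vector_measure H \<mu>" "range E \<subseteq> H" "disjoint_family E"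
  shows "(\<lambda>n. \<mu> (E n)) \<longlonglongrightarrow> 0"
proof -
  have s: "(\<lambda>n. \<mu> (E n)) sums \<mu> (\<Union>n. E n)" using vector_measureD[OF assms] .
  have "(\<lambda>n. (\<Sum>i<Suc n. \<mu> (E i)) - (\<Sum>i<n. \<mu> (E i))) \<longlonglongrightarrow> \<mu> (\<Union>n. E n) - \<mu> (\<Union>n. E n)"
    using s unfolding sums_def by (intro tendsto_diff LIMSEQ_Suc)
  then show ?thesis by simp
qed

context sigma_algebra
begin

lemmas vector_measure_UN = vector_measure_finite_UN[OF sigma_algebra_axioms]

lemma vector_measure_split:
  assumes "vector_measure M \<mu>" "A \<in> M" "B \<in> M"
  shows "\<mu> A = \<mu> (A \<inter> B) + \<mu> (A - B)"
proof -
  have "A \<inter> B \<union> (A - B) = A" "A \<inter> B \<inter> (A - B) = {}" by auto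
  then show ?thesis
    using vector_measure_Un[OF sigma_algebra_axioms assms(1), of "A \<inter> B" "A - B"] assms by auto
qed

lemma vector_measure_incseq:
  assumes "vector_measure M \<mu>" "range C \<subseteq> M" "incseq C"
  shows "(\<lambda>n. \<mu> (C n)) \<longlonglongrightarrow> \<mu> (\<Union>n. C n)"
proof -
  have d: "range (disjointed C) \<subseteq> M" using range_disjointed_sets[OF assms(2)] .
  have "(\<Sum>i<Suc n. \<mu> (disjointed C i)) = \<mu> (C n)" for n
  proof -
    have "(\<Sum>i<Suc n. \<mu> (disjointed C i)) = \<mu> (\<Union>i<Suc n. disjointed C i)"
      using d disjoint_family_disjointed[of C]
      by (intro vector_measure_UN[OF assms(1), symmetric]) (auto simp: disjoint_family_on_def)
    also have "(\<Union>i<Suc n. disjointed C i) = C n"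
      using assms(3) finite_UN_disjointed_eq[of C "Suc n"]
      by (force simp: atLeast0LessThan incseq_def less_Suc_eq_le)
    finally show ?thesis .
  qed
  then show ?thesis
    using vector_measureD[OF assms(1) d disjoint_family_disjointed] UN_disjointed_eq[of C]
    unfolding sums_def by (metis (no_types, lifting) LIMSEQ_Suc ext)
qed

text \<open>Exhaustivity in Cauchy form. If no finite \<open>J\<close> worked, one could choose finite index sets
  successively, each outside the earlier ones, with values outside \<open>U\<close>; the corresponding unions are
  disjoint, so their values tend to zero.\<close>

lemma vector_measure_finite_tail:
  assumes \<mu>: "vector_measure M \<mu>" and B: "\<And>i. i \<in> I \<Longrightarrow> B i \<in> M" "disjoint_family_on B I"
    and U: "open U" "0 \<in> U"
  shows "\<exists>J. finite J \<and> J \<subseteq> I \<and> (\<forall>K. finite K \<and> K \<subseteq> I - J \<longrightarrow> \<mu> (\<Union>i\<in>K. B i) \<in> U)"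
proof (rule ccontr)
  assume neg: "\<not> ?thesis"
  have *: "\<exists>K. finite K \<and> K \<subseteq> I - J \<and> \<mu> (\<Union>i\<in>K. B i) \<notin> U" if J: "finite J" "J \<subseteq> I" for J
    using neg J by (metis (no_types, lifting))
  have "\<exists>S. \<forall>n::nat. (finite (S n) \<and> S n \<subseteq> I) \<and>
      (S n \<subseteq> S (Suc n) \<and> \<mu> (\<Union>i\<in>S (Suc n) - S n. B i) \<notin> U)"
  proof (rule dependent_nat_choice)
    show "\<exists>J. finite J \<and> J \<subseteq> I" by (rule exI[of _ "{}"]) simp
  next
    fix J and n :: nat assume J: "finite J \<and> J \<subseteq> I"
    obtain K where K: "finite K" "K \<subseteq> I - J" "\<mu> (\<Union>i\<in>K. B i) \<notin> U"
      using *[OF conjunct1[OF J] conjunct2[OF J]] by (elim exE conjE)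
    have JK: "J \<union> K - J = K" using K(2) by auto
    show "\<exists>y. (finite y \<and> y \<subseteq> I) \<and> J \<subseteq> y \<and> \<mu> (\<Union>i\<in>y - J. B i) \<notin> U"
    proof (intro exI conjI)
      show "\<mu> (\<Union>i\<in>J \<union> K - J. B i) \<notin> U" using K(3) unfolding JK .
    qed (use J K in auto)
  qed
  then obtain S where "\<forall>n::nat. (finite (S n) \<and> S n \<subseteq> I) \<and>
      (S n \<subseteq> S (Suc n) \<and> \<mu> (\<Union>i\<in>S (Suc n) - S n. B i) \<notin> U)" ..
  then have S: "\<And>n. finite (S n)" "\<And>n. S n \<subseteq> I" "\<And>n. S n \<subseteq> S (Suc n)"
    "\<And>n. \<mu> (\<Union>i\<in>S (Suc n) - S n. B i) \<notin> U" by simp_all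
  define E where "E n = (\<Union>i\<in>S (Suc n) - S n. B i)" for n
  have inc: "S m \<subseteq> S n" if "m \<le> n" for m n using S(3) that by (rule lift_Suc_mono_le)
  have "E n \<in> M" for n
    using S(1)[of "Suc n"] S(2)[of "Suc n"] B(1) unfolding E_def by (intro finite_UN) auto
  then have "range E \<subseteq> M" by blast
  moreover have "E m \<inter> E n = {}" if "m < n" for m n
  proof -
    have "S (Suc m) \<subseteq> S n" using inc that by auto
    then have "i \<noteq> j" "i \<in> I" "j \<in> I" if "i \<in> S (Suc m) - S m" "j \<in> S (Suc n) - S n" for i j
      using that S(2)[of "Suc m"] S(2)[of "Suc n"] by auto
    then have "B i \<inter> B j = {}" if "i \<in> S (Suc m) - S m" "j \<in> S (Suc n) - S n" for i j
      using B(2) that unfolding disjoint_family_on_def by metis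
    then show ?thesis by (fastforce simp: E_def)
  qed
  then have "disjoint_family E"
    unfolding disjoint_family_on_def by (metis linorder_neqE_nat Int_commute)
  ultimately have "(\<lambda>n. \<mu> (E n)) \<longlonglongrightarrow> 0" by (rule vector_measure_disjoint_tendsto_0[OF \<mu>])
  then have "\<forall>\<^sub>F n in sequentially. \<mu> (E n) \<in> U" using U by (rule topological_tendstoD)
  then show False using S(4) by (simp add: E_def)
qed

text \<open>For sequences, infinite sets of indices are allowed as well: the value on an infinite union is a
  limit of values on finite ones and thus lies in the closure of a smaller neighbourhood.\<close>

lemma vector_measure_tail:
  assumes \<mu>: "vector_measure M \<mu>" and B: "range B \<subseteq> M" "disjoint_family B"
    and U: "open U" "0 \<in> U"
  obtains q :: nat where "\<And>K. K \<subseteq> {q..} \<Longrightarrow> \<mu> (\<Union>i\<in>K. B i) \<in> U"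
proof -
  obtain V where V: "open V" "0 \<in> V" "closure V \<subseteq> U"
    using zero_neighbourhood_arith[OF U] by metis
  obtain J where J: "finite J"
    "\<And>K. finite K \<Longrightarrow> K \<subseteq> UNIV - J \<Longrightarrow> \<mu> (\<Union>i\<in>K. B i) \<in> V"
    using vector_measure_finite_tail[OF \<mu>, of UNIV B V] B V by (metis rangeI subsetD)
  obtain q where q: "J \<subseteq> {..<q}" using finite_nat_iff_bounded J(1) by blast
  show ?thesis
  proof (rule that)
    fix K assume K: "K \<subseteq> {q..}"
    let ?C = "\<lambda>n. \<Union>i\<in>K \<inter> {..<n}. B i"
    have "(\<lambda>n. \<mu> (?C n)) \<longlonglongrightarrow> \<mu> (\<Union>n. ?C n)"
    proof (rule vector_measure_incseq[OF \<mu>])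
      show "range ?C \<subseteq> M" using B(1) by (auto intro!: finite_UN)
      show "incseq ?C" unfolding incseq_def by (auto intro: order.strict_trans2)
    qed
    moreover have "(\<Union>n. ?C n) = (\<Union>i\<in>K. B i)" by auto
    ultimately have lim: "(\<lambda>n. \<mu> (?C n)) \<longlonglongrightarrow> \<mu> (\<Union>i\<in>K. B i)" by (simp only:)
    have "K \<inter> J = {}" using K q by fastforce
    then have "\<mu> (?C n) \<in> closure V" for n
      by (intro subsetD[OF closure_subset] J(2)) auto
    then have "\<mu> (\<Union>i\<in>K. B i) \<in> closure V"
      by (intro Lim_in_closed_set[OF closed_closure _ _ lim]) simp_all
    then show "\<mu> (\<Union>i\<in>K. B i) \<in> U" by (rule subsetD[OF V(3)])
  qed
qed


text \<open>A Baire category argument on the sets \<open>K\<close> of indices. If the convergence were not uniformly Cauchy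
  on any cylinder of sets with a prescribed initial segment, one could extend initial segments
  step by step, at step \<open>i\<close> forcing \<open>\<nu> n - \<nu> k\<close> to stay outside a neighbourhood of zero for some
  \<open>n, k \<ge> i\<close> on the whole cylinder; the set with all these initial segments would contradict the
  convergence. A cylinder with uniform convergence is translated to the tail by subtracting its
  initial segment.\<close>

lemma nikodym_uniform_tail:
  assumes \<nu>: "\<And>n. vector_measure M (\<nu> n)" and lim: "\<And>A. A \<in> M \<Longrightarrow> (\<lambda>n. \<nu> n A) \<longlonglongrightarrow> \<nu>' A"
    and B: "range B \<subseteq> M" "disjoint_family (B :: nat \<Rightarrow> _)" and U: "open U" "0 \<in> U"
  shows "\<exists>m q. \<forall>K. K \<subseteq> {q..} \<longrightarrow> \<nu>' (\<Union>i\<in>K. B i) - \<nu> m (\<Union>i\<in>K. B i) \<in> U"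
proof -
  define T where "T K = (\<Union>i\<in>K. B i)" for K :: "nat set"
  have TM: "T K \<in> M" for K
    using B(1) unfolding T_def by (intro countable_UN') auto
  have split: "\<kappa> (T K) = \<kappa> (T (K \<inter> L)) + \<kappa> (T (K - L))"
    if "vector_measure M \<kappa>" for \<kappa> :: "'a set \<Rightarrow> 'b" and K L
  proof -
    have same: "i = j" if "x \<in> B i" "x \<in> B j" for i j x
      using B(2) that unfolding disjoint_family_on_def by (metis IntI UNIV_I empty_iff)
    have "T K \<inter> T L = T (K \<inter> L)" "T K - T L = T (K - L)"
      unfolding T_def by (auto dest: same)
    then show ?thesis using vector_measure_split[OF that TM TM, of K L] by simp
  qed
  obtain V where V: "open V" "0 \<in> V" "closure V \<subseteq> U"
    using zero_neighbourhood_arith[OF U] by metis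
  obtain W where W: "open W" "0 \<in> W" "\<And>x y. x \<in> W \<Longrightarrow> y \<in> W \<Longrightarrow> x - y \<in> V"
    using zero_neighbourhood_arith[OF V(1,2)] by metis
  obtain X where X: "open X" "0 \<in> X" "\<And>x y. x \<in> X \<Longrightarrow> y \<in> X \<Longrightarrow> x - y \<in> W"
    using zero_neighbourhood_arith[OF W(1,2)] by metis
  obtain Y where Y: "open Y" "0 \<in> Y" "\<And>x y. x \<in> Y \<Longrightarrow> y \<in> Y \<Longrightarrow> x - y \<in> X"
    using zero_neighbourhood_arith[OF X(1,2)] by metis
  (* Cutting p down to {..<q} makes every p describe a nonempty cylinder. *)
  have "\<exists>m q p. \<forall>K. K \<inter> {..<q} = p \<inter> {..<q} \<longrightarrow> (\<forall>n\<ge>m. \<forall>k\<ge>m. \<nu> n (T K) - \<nu> k (T K) \<in> W)"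
    (is "\<exists>m q p. ?stable m q p")
  proof (rule ccontr)
    assume unstable: "\<nexists>m q p. ?stable m q p"
    let ?far = "\<lambda>i q p. \<exists>n\<ge>i. \<exists>k\<ge>i. \<forall>K. K \<inter> {..<q} = p \<longrightarrow> \<nu> n (T K) - \<nu> k (T K) \<notin> X"
    let ?step = "\<lambda>i (q, p) (q', p'). q \<le> q' \<and> p' \<inter> {..<q} = p \<and> ?far i q' p'"
    have step: "\<exists>q' p'. p' \<subseteq> {..<q'} \<and> q \<le> q' \<and> p' \<inter> {..<q} = p \<and> ?far i q' p'"
      if "p \<subseteq> {..<q}" for i q p
    proof -
      have "p \<inter> {..<q} = p" using that by blast
      moreover have "\<not> ?stable i q p" using unstable by metis
      ultimately obtain K n k
        where K: "K \<inter> {..<q} = p" "n \<ge> i" "k \<ge> i" "\<nu> n (T K) - \<nu> k (T K) \<notin> W"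
        by metis
      define \<kappa> where "\<kappa> A = \<nu> n A - \<nu> k A" for A
      have \<kappa>: "vector_measure M \<kappa>" unfolding \<kappa>_def by (intro vector_measure_diff \<nu>)
      obtain r where r: "\<And>L. L \<subseteq> {r..} \<Longrightarrow> \<kappa> (T L) \<in> Y"
        using vector_measure_tail[OF \<kappa> B Y(1,2)] unfolding T_def by metis
      define q' where "q' = max q r"
      (* Sets that agree below q' have nearly the same value, so failure at K spreads to the cylinder. *)
      have "\<kappa> (T L) \<notin> X" if L: "L \<inter> {..<q'} = K \<inter> {..<q'}" for L
      proof
        assume "\<kappa> (T L) \<in> X"
        moreover have "\<kappa> (T (L - {..<q'})) \<in> Y" "\<kappa> (T (K - {..<q'})) \<in> Y"
          by (rule r; force simp: q'_def)+
        then have "\<kappa> (T (L - {..<q'})) - \<kappa> (T (K - {..<q'})) \<in> X" by (rule Y(3))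
        ultimately have "\<kappa> (T L) - (\<kappa> (T (L - {..<q'})) - \<kappa> (T (K - {..<q'}))) \<in> W" by (rule X(3))
        also have "\<kappa> (T L) - (\<kappa> (T (L - {..<q'})) - \<kappa> (T (K - {..<q'}))) = \<kappa> (T K)"
          using split[OF \<kappa>, of L "{..<q'}"] split[OF \<kappa>, of K "{..<q'}"] L by simp
        finally show False using K(4) by (simp add: \<kappa>_def)
      qed
      then have "?far i q' (K \<inter> {..<q'})"
        using K(2,3) unfolding \<kappa>_def by (intro exI[of _ n] exI[of _ k] conjI allI impI) simp_all
      moreover have "K \<inter> {..<q'} \<inter> {..<q} = p" using K(1) by (force simp: q'_def)
      moreover have "q \<le> q'" by (simp add: q'_def)
      ultimately show ?thesis by (intro exI[of _ q'] exI[of _ "K \<inter> {..<q'}"]) simp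
    qed
    have "\<exists>s. \<forall>i. snd (s i) \<subseteq> {..<fst (s i)} \<and> ?step i (s i) (s (Suc i))"
    proof (rule dependent_nat_choice)
      show "\<exists>x :: nat \<times> nat set. snd x \<subseteq> {..<fst x}" by (rule exI[of _ "(0, {})"]) simp
    next
      fix x :: "nat \<times> nat set" and i assume x': "snd x \<subseteq> {..<fst x}"
      obtain q p where x: "x = (q, p)" by (cases x)
      obtain q' p' where "p' \<subseteq> {..<q'} \<and> q \<le> q' \<and> p' \<inter> {..<q} = p \<and> ?far i q' p'"
        using step[of p q i, OF x'[unfolded x fst_conv snd_conv]] by (elim exE)
      then show "\<exists>y. snd y \<subseteq> {..<fst y} \<and> ?step i x y"
        by (intro exI[of _ "(q', p')"]) (simp add: x)
    qed
    then obtain s where s: "\<forall>i. snd (s i) \<subseteq> {..<fst (s i)} \<and> ?step i (s i) (s (Suc i))" ..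
    define q p where "q i = fst (s i)" and "p i = snd (s i)" for i
    have p: "p i \<subseteq> {..<q i}" and q: "q i \<le> q (Suc i)" and ext: "p (Suc i) \<inter> {..<q i} = p i"
      and far: "?far i (q (Suc i)) (p (Suc i))" for i
      using s[rule_format, of i] by (simp_all add: q_def p_def case_prod_beta)
    have qmono: "q i \<le> q j" if "i \<le> j" for i j using lift_Suc_mono_le[of q, OF q that] .
    have ext': "p j \<inter> {..<q i} = p i" if "i \<le> j" for i j
      using that
    proof (induction j rule: dec_induct)
      case base show ?case using p by blast
    next
      case (step j)
      have "p (Suc j) \<inter> {..<q i} = p (Suc j) \<inter> {..<q j} \<inter> {..<q i}"
        using qmono[OF step.hyps(1)] by auto
      then show ?case using ext[of j] step.IH by simp
    qed
    define K where "K = (\<Union>i. p i)"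
    have K: "K \<inter> {..<q i} = p i" for i
    proof -
      have "p j \<inter> {..<q i} \<subseteq> p i" for j
        using ext'[of i j] ext'[of j i] by (cases "i \<le> j") auto
      then show ?thesis using p[of i] by (auto simp: K_def)
    qed
    have "tvs_Cauchy (\<lambda>n. \<nu> n (T K))" using tvs_Cauchy_if_LIMSEQ[OF lim[OF TM]] .
    then obtain N where N: "\<And>n k. n \<ge> N \<Longrightarrow> k \<ge> N \<Longrightarrow> \<nu> n (T K) - \<nu> k (T K) \<in> X"
      using X(1,2) unfolding tvs_Cauchy_def by metis
    show False using far[of N] K[of "Suc N"] N by metis
  qed
  then obtain m q p where stable: "?stable m q p" by (elim exE)
  have "\<nu>' (T K) - \<nu> m (T K) \<in> U" if "K \<subseteq> {q..}" for K
  proof -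
    define p' where "p' = p \<inter> {..<q}"
    have p': "p' \<subseteq> {..<q}" by (simp add: p'_def)
    have near: "\<nu> n (T K) - \<nu> m (T K) \<in> closure V" if n: "n \<ge> m" for n
    proof -
      have *: "\<nu> n (T L) - \<nu> m (T L) \<in> W" if "L \<inter> {..<q} = p'" for L
        using stable that n unfolding p'_def by (metis order_refl)
      have p'K: "(K \<union> p') \<inter> p' = p'" "(K \<union> p') - p' = K" "(K \<union> p') \<inter> {..<q} = p'"
        "p' \<inter> {..<q} = p'"
        using p' \<open>K \<subseteq> {q..}\<close> by force+
      have "\<nu> n (T K) - \<nu> m (T K) =
          (\<nu> n (T (K \<union> p')) - \<nu> m (T (K \<union> p'))) - (\<nu> n (T p') - \<nu> m (T p'))"
        using split[OF \<nu>, of n "K \<union> p'" p'] split[OF \<nu>, of m "K \<union> p'" p'] p'K by simp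
      also have "\<dots> \<in> V" using p'K by (intro W(3) *)
      finally show ?thesis by (rule subsetD[OF closure_subset])
    qed
    have "(\<lambda>n. \<nu> n (T K) - \<nu> m (T K)) \<longlonglongrightarrow> \<nu>' (T K) - \<nu> m (T K)"
      by (intro tendsto_diff tendsto_const lim TM)
    then have "\<nu>' (T K) - \<nu> m (T K) \<in> closure V"
      by (rule Lim_in_closed_set[OF closed_closure, rotated 2])
        (use near in \<open>auto simp: eventually_sequentially\<close>)
    then show ?thesis by (rule subsetD[OF V(3)])
  qed
  then show ?thesis unfolding T_def by blast
qed

text \<open>The Nikodym convergence theorem: on a far tail \<open>\<nu>'\<close> is close to a single \<open>\<nu> m\<close>, whose own tails
  vanish.\<close>

theorem nikodym_convergence:
  assumes \<nu>: "\<And>n. vector_measure M (\<nu> n)" and lim: "\<And>A. A \<in> M \<Longrightarrow> (\<lambda>n. \<nu> n A) \<longlonglongrightarrow> \<nu>' A"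
  shows "vector_measure M \<nu>'"
  unfolding vector_measure_def
proof (intro allI impI, elim conjE)
  fix B :: "nat \<Rightarrow> 'a set" assume B: "range B \<subseteq> M" "disjoint_family B"
  have UNM: "(\<Union>i\<in>K. B i) \<in> M" for K :: "nat set"
    using B(1) by (intro countable_UN') auto
  have additive: "\<nu>' (\<Union>i. B i) - (\<Sum>i<r. \<nu>' (B i)) = \<nu>' (\<Union>i\<in>{r..}. B i)" for r
  proof (rule LIMSEQ_unique)
    show "(\<lambda>n. \<nu> n (\<Union>i\<in>{r..}. B i)) \<longlonglongrightarrow> \<nu>' (\<Union>i\<in>{r..}. B i)" by (intro lim UNM)
    have "\<nu> n (\<Union>i\<in>{r..}. B i) = \<nu> n (\<Union>i. B i) - (\<Sum>i<r. \<nu> n (B i))" for n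
    proof -
      have "(\<Union>i. B i) \<inter> (\<Union>i<r. B i) = (\<Union>i<r. B i)" by blast
      moreover have "(\<Union>i. B i) - (\<Union>i<r. B i) = (\<Union>i\<in>{r..}. B i)"
      proof (intro equalityI subsetI)
        fix x assume "x \<in> (\<Union>i. B i) - (\<Union>i<r. B i)"
        then obtain i where "x \<in> B i" "\<not> i < r" by blast
        then show "x \<in> (\<Union>i\<in>{r..}. B i)" by (intro UN_I[of i]) auto
      next
        fix x assume "x \<in> (\<Union>i\<in>{r..}. B i)"
        then obtain i where i: "i \<ge> r" "x \<in> B i" by auto
        then have "x \<notin> B j" if "j < r" for j
          using B(2) that unfolding disjoint_family_on_def by (metis IntI UNIV_I empty_iff not_le)
        then show "x \<in> (\<Union>i. B i) - (\<Union>i<r. B i)" using i by blast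
      qed
      moreover have "\<nu> n (\<Union>i<r. B i) = (\<Sum>i<r. \<nu> n (B i))"
        using B by (intro vector_measure_UN[OF \<nu>]) (auto simp: disjoint_family_on_def)
      ultimately show ?thesis
        using vector_measure_split[OF \<nu> UNM UNM, of n UNIV "{..<r}"] by simp
    qed
    then show "(\<lambda>n. \<nu> n (\<Union>i\<in>{r..}. B i)) \<longlonglongrightarrow> \<nu>' (\<Union>i. B i) - (\<Sum>i<r. \<nu>' (B i))"
      using B(1) by (simp only:) (intro tendsto_diff tendsto_sum lim UNM; blast)
  qed
  show "(\<lambda>n. \<nu>' (B n)) sums \<nu>' (\<Union>n. B n)"
    unfolding sums_def tendsto_iff_zero_neighbourhoods
  proof (intro allI impI, elim conjE)
    fix U :: "'b set" assume "open U" "0 \<in> U"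
    then obtain W where W: "open W" "0 \<in> W" "\<And>x y. x \<in> W \<Longrightarrow> y \<in> W \<Longrightarrow> x - y \<in> U"
      using zero_neighbourhood_arith[of U] by metis
    obtain V where V: "open V" "0 \<in> V" "\<And>x y. x \<in> V \<Longrightarrow> y \<in> V \<Longrightarrow> x + y \<in> W"
      using zero_neighbourhood_arith[OF W(1,2)] by metis
    obtain m q where q: "\<And>K. K \<subseteq> {q..} \<Longrightarrow>
        \<nu>' (\<Union>i\<in>K. B i) - \<nu> m (\<Union>i\<in>K. B i) \<in> V"
      using nikodym_uniform_tail[of \<nu> \<nu>' B V, OF \<nu> lim B V(1,2)] by metis
    obtain q' where q': "\<And>K. K \<subseteq> {q'..} \<Longrightarrow> \<nu> m (\<Union>i\<in>K. B i) \<in> V"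
      using vector_measure_tail[OF \<nu> B V(1,2)] by metis
    show "\<forall>\<^sub>F r in sequentially. (\<Sum>i<r. \<nu>' (B i)) - \<nu>' (\<Union>n. B n) \<in> U"
      unfolding eventually_sequentially
    proof (intro exI allI impI)
      fix r assume "max q q' \<le> r"
      then have "{r..} \<subseteq> {q..}" "{r..} \<subseteq> {q'..}" by auto
      from V(3)[OF q[OF this(1)] q'[OF this(2)]]
      have "\<nu>' (\<Union>i\<in>{r..}. B i) \<in> W" by simp
      then have "0 - \<nu>' (\<Union>i\<in>{r..}. B i) \<in> U" by (rule W(3)[OF W(2)])
      then show "(\<Sum>i<r. \<nu>' (B i)) - \<nu>' (\<Union>n. B n) \<in> U" by (simp flip: additive)
    qed
  qed
qed

end


section \<open>Unconditional summability\<close>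

lemma finite_subset_incseq:
  assumes "finite J" "incseq S" "J \<subseteq> (\<Union>n::nat. S n)"
  shows "\<exists>n. J \<subseteq> S n"
  using assms(1,3)
proof (induction J rule: finite_induct)
  case (insert x J)
  then obtain m n where mn: "J \<subseteq> S m" "x \<in> S n" by auto
  have "S m \<subseteq> S (max m n)" "S n \<subseteq> S (max m n)" using assms(2) by (simp_all add: incseq_def)
  then have "insert x J \<subseteq> S (max m n)" using mn by auto
  then show ?case ..
qed simp

text \<open>For a family that satisfies the Cauchy criterion, one exhausting sequence of finite sets determines
  the limit of the whole net: any finite set that contains a late member of the sequence differs from
  it by a set with a small sum.\<close>

lemma has_sum_if_exhaustion:
  fixes \<phi> :: "'i \<Rightarrow> 'x::topological_ab_group_add"
  assumes Cauchy: "\<And>U. open U \<Longrightarrow> 0 \<in> U \<Longrightarrow>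
      \<exists>J. finite J \<and> J \<subseteq> P \<and> (\<forall>K. finite K \<and> K \<subseteq> P - J \<longrightarrow> sum \<phi> K \<in> U)"
    and S: "\<And>n::nat. finite (S n)" "incseq S" "(\<Union>n. S n) = P"
    and lim: "(\<lambda>n. sum \<phi> (S n)) \<longlonglongrightarrow> z"
  shows "(\<phi> has_sum z) P"
  unfolding has_sum_def tendsto_iff_zero_neighbourhoods
proof (intro allI impI, elim conjE)
  fix U :: "'x set" assume U: "open U" "0 \<in> U"
  obtain V where V: "open V" "0 \<in> V" "\<And>x y. x \<in> V \<Longrightarrow> y \<in> V \<Longrightarrow> x + y \<in> U"
    using zero_neighbourhood_arith[OF U] by metis
  obtain J where J: "finite J" "J \<subseteq> P" "\<And>K. finite K \<Longrightarrow> K \<subseteq> P - J \<Longrightarrow> sum \<phi> K \<in> V"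
    using Cauchy[OF V(1,2)] by metis
  obtain m where m: "J \<subseteq> S m" using finite_subset_incseq[OF J(1) S(2)] J(2) S(3) by metis
  have "\<forall>\<^sub>F n in sequentially. sum \<phi> (S n) - z \<in> V"
    using lim V unfolding tendsto_iff_zero_neighbourhoods by metis
  then obtain n where n: "n \<ge> m" "sum \<phi> (S n) - z \<in> V"
    unfolding eventually_sequentially by (metis linear)
  have SP: "S n \<subseteq> P" and JS: "J \<subseteq> S n" using S(2,3) m n(1) unfolding incseq_def by blast+
  show "\<forall>\<^sub>F K in finite_subsets_at_top P. sum \<phi> K - z \<in> U"
    unfolding eventually_finite_subsets_at_top
  proof (intro exI conjI allI impI)
    fix K assume K: "finite K \<and> S n \<subseteq> K \<and> K \<subseteq> P"
    then have "sum \<phi> K = sum \<phi> (K - S n) + sum \<phi> (S n)" by (intro sum.subset_diff) auto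
    moreover have "sum \<phi> (K - S n) \<in> V" using K JS by (intro J(3)) auto
    ultimately show "sum \<phi> K - z \<in> U" using V(3) n(2) by (metis add_diff_eq)
  qed (use S(1) SP in auto)
qed

lemma countable_exhaustion:
  assumes "countable P"
  obtains S :: "nat \<Rightarrow> 'i set" where "\<And>n. finite (S n)" "incseq S" "(\<Union>n. S n) = P"
proof
  show "finite {p \<in> P. to_nat_on P p < n}" for n
  proof (rule finite_imageD[of "to_nat_on P"])
    show "finite (to_nat_on P ` {p \<in> P. to_nat_on P p < n})"
      by (rule finite_subset[of _ "{..<n}"]) auto
    show "inj_on (to_nat_on P) {p \<in> P. to_nat_on P p < n}"
      using inj_on_to_nat_on[OF assms] by (rule inj_on_subset) auto
  qed
  show "incseq (\<lambda>n. {p \<in> P. to_nat_on P p < n})" by (auto simp: incseq_def)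
  show "(\<Union>n. {p \<in> P. to_nat_on P p < n}) = P" by auto
qed

lemma summable_on_if_Cauchy:
  fixes \<phi> :: "'i \<Rightarrow> 'x::hausdorff_tvs"
  assumes complete: "sequentially_complete TYPE('x)" and P: "countable P"
    and Cauchy: "\<And>U. open U \<Longrightarrow> 0 \<in> U \<Longrightarrow>
      \<exists>J. finite J \<and> J \<subseteq> P \<and> (\<forall>K. finite K \<and> K \<subseteq> P - J \<longrightarrow> sum \<phi> K \<in> U)"
  shows "\<phi> summable_on P"
proof -
  obtain S :: "nat \<Rightarrow> 'i set" where S: "\<And>n. finite (S n)" "incseq S" "(\<Union>n. S n) = P"
    using countable_exhaustion[OF P] by metis
  have "tvs_Cauchy (\<lambda>n. sum \<phi> (S n))"
    unfolding tvs_Cauchy_def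
  proof (intro allI impI, elim conjE)
    fix U :: "'x set" assume U: "open U" "0 \<in> U"
    obtain V where V: "open V" "0 \<in> V" "\<And>x y. x \<in> V \<Longrightarrow> y \<in> V \<Longrightarrow> x - y \<in> U"
      using zero_neighbourhood_arith[OF U] by metis
    obtain J where J: "finite J" "J \<subseteq> P" "\<And>K. finite K \<Longrightarrow> K \<subseteq> P - J \<Longrightarrow> sum \<phi> K \<in> V"
      using Cauchy[OF V(1,2)] by metis
    obtain N where N: "J \<subseteq> S N" using finite_subset_incseq[OF J(1) S(2)] J(2) S(3) by metis
    have tail: "sum \<phi> (S n) - sum \<phi> (S N) \<in> V" if "n \<ge> N" for n
    proof -
      have "S N \<subseteq> S n" using S(2) that unfolding incseq_def by blast
      then have "sum \<phi> (S n) - sum \<phi> (S N) = sum \<phi> (S n - S N)"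
        using S(1) by (simp add: sum_diff)
      also have "\<dots> \<in> V" using S N by (intro J(3)) auto
      finally show ?thesis .
    qed
    have "sum \<phi> (S m) - sum \<phi> (S n) \<in> U" if "m \<ge> N" "n \<ge> N" for m n
      using V(3)[OF tail[OF that(1)] tail[OF that(2)]] by simp
    then show "\<exists>N. \<forall>m\<ge>N. \<forall>n\<ge>N. sum \<phi> (S m) - sum \<phi> (S n) \<in> U" by metis
  qed
  then obtain z where lim: "(\<lambda>n. sum \<phi> (S n)) \<longlonglongrightarrow> z"
    using complete unfolding sequentially_complete_def convergent_def by metis
  have "(\<phi> has_sum z) P" by (rule has_sum_if_exhaustion[OF _ S lim]) (rule Cauchy)
  then show ?thesis by (auto simp: summable_on_def)
qed

context sigma_algebra
begin

lemma vector_measure_sum: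
  assumes "vector_measure M \<mu>" "finite K" "K \<subseteq> M" "disjoint K"
  shows "\<mu> (\<Union>K) = sum \<mu> K"
  using vector_measure_UN[OF assms(1,2), of id] assms(3,4)
  by (auto simp: disjoint_def disjoint_family_on_def)

lemma vector_measure_Cauchy:
  assumes \<mu>: "vector_measure M \<mu>" and P: "P \<subseteq> M" "disjoint P" and U: "open U" "0 \<in> U"
  shows "\<exists>J. finite J \<and> J \<subseteq> P \<and> (\<forall>K. finite K \<and> K \<subseteq> P - J \<longrightarrow> \<mu> (\<Union>K) \<in> U)"
  using vector_measure_finite_tail[OF \<mu>, of P id U] P U
  by (force simp: disjoint_def disjoint_family_on_def)

lemma vector_measure_has_sum:
  assumes \<mu>: "vector_measure M \<mu>" and P: "countable P" "P \<subseteq> M" "disjoint P"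
  shows "(\<mu> has_sum \<mu> (\<Union>P)) P"
proof -
  obtain S :: "nat \<Rightarrow> 'a set set" where S: "\<And>n. finite (S n)" "incseq S" "(\<Union>n. S n) = P"
    using countable_exhaustion[OF P(1)] by metis
  have sum: "\<mu> (\<Union>K) = sum \<mu> K" if "finite K" "K \<subseteq> P" for K
    using that P(2) by (intro vector_measure_sum[OF \<mu>] pairwise_subset[OF P(3)]) auto
  have SP: "S n \<subseteq> P" for n using S(3) by blast
  show ?thesis
  proof (rule has_sum_if_exhaustion[OF _ S])
    fix U :: "'b set" assume "open U" "0 \<in> U"
    then obtain J where J: "finite J" "J \<subseteq> P" "\<And>K. finite K \<Longrightarrow> K \<subseteq> P - J \<Longrightarrow> \<mu> (\<Union>K) \<in> U"
      using vector_measure_Cauchy[OF \<mu> P(2,3)] by metis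
    have "sum \<mu> K \<in> U" if "finite K" "K \<subseteq> P - J" for K
    proof -
      have "K \<subseteq> P" using that(2) by blast
      then show ?thesis using J(3)[OF that] sum[OF that(1)] by simp
    qed
    then show "\<exists>J. finite J \<and> J \<subseteq> P \<and> (\<forall>K. finite K \<and> K \<subseteq> P - J \<longrightarrow> sum \<mu> K \<in> U)"
      using J(1,2) by metis
  next
    have "(\<lambda>n. \<mu> (\<Union>(S n))) \<longlonglongrightarrow> \<mu> (\<Union>n. \<Union>(S n))"
    proof (rule vector_measure_incseq[OF \<mu>])
      show "range (\<lambda>n. \<Union>(S n)) \<subseteq> M"
        using S(1) SP P(2) by (force intro!: finite_Union)
      show "incseq (\<lambda>n. \<Union>(S n))" using S(2) unfolding incseq_def by blast
    qed
    moreover have "(\<Union>n. \<Union>(S n)) = \<Union>P" using S(3) by blast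
    ultimately show "(\<lambda>n. sum \<mu> (S n)) \<longlonglongrightarrow> \<mu> (\<Union>P)" by (simp add: sum[OF S(1) SP])
  qed
qed


section \<open>Integrals of simple functions\<close>

lemma simple_function_level_sets:
  assumes "simple_function (sigma \<Omega> M) h"
  shows "finite (h ` \<Omega>)" "\<And>X. h -` X \<inter> \<Omega> \<in> M"
  using simple_functionD[OF assms] by (simp_all add: space_closed)

lemma simple_integral_vector_measure:
  assumes \<mu>: "vector_measure M \<mu>" and h: "simple_function (sigma \<Omega> M) h"
  shows "vector_measure M (\<lambda>A. vm_simple_integral \<Omega> \<mu> A h)"
  unfolding vector_measure_def
proof (intro allI impI, elim conjE)
  fix A :: "nat \<Rightarrow> 'a set" assume A: "range A \<subseteq> M" "disjoint_family A"
  let ?E = "\<lambda>c. h -` {c} \<inter> \<Omega>"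
  have "(\<lambda>n. \<Sum>i<n. \<mu> (A i \<inter> ?E c)) \<longlonglongrightarrow> \<mu> ((\<Union>n. A n) \<inter> ?E c)" for c
  proof -
    have "(\<lambda>n. \<mu> (A n \<inter> ?E c)) sums \<mu> (\<Union>n. A n \<inter> ?E c)"
      using A simple_function_level_sets(2)[OF h, of "{c}"]
      by (intro vector_measureD[OF \<mu>]) (auto simp: disjoint_family_on_def)
    moreover have "(\<Union>n. A n \<inter> ?E c) = (\<Union>n. A n) \<inter> ?E c" by blast
    ultimately show ?thesis by (simp add: sums_def)
  qed
  then have "(\<lambda>n. \<Sum>c\<in>h ` \<Omega>. c *\<^sub>R (\<Sum>i<n. \<mu> (A i \<inter> ?E c)))
      \<longlonglongrightarrow> (\<Sum>c\<in>h ` \<Omega>. c *\<^sub>R \<mu> ((\<Union>n. A n) \<inter> ?E c))"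
    by (intro tendsto_sum tendsto_scaleR_tvs)
  also have "(\<lambda>n. \<Sum>c\<in>h ` \<Omega>. c *\<^sub>R (\<Sum>i<n. \<mu> (A i \<inter> ?E c))) =
      (\<lambda>n. \<Sum>i<n. \<Sum>c\<in>h ` \<Omega>. c *\<^sub>R \<mu> (A i \<inter> ?E c))"
    unfolding scaleR_sum_right by (rule ext, rule sum.swap)
  finally show "(\<lambda>n. vm_simple_integral \<Omega> \<mu> (A n) h) sums vm_simple_integral \<Omega> \<mu> (\<Union>n. A n) h"
    by (simp add: sums_def vm_simple_integral_def)
qed

text \<open>The level sets of \<open>g\<close> and \<open>h\<close>, taken side by side as a disjoint sum of index sets, represent the
  difference.\<close>

lemma simple_integral_diff:
  assumes \<mu>: "vector_measure M \<mu>" and A: "A \<in> M"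
    and g: "simple_function (sigma \<Omega> M) g" and h: "simple_function (sigma \<Omega> M) h"
  shows "vm_simple_integral \<Omega> \<mu> A (\<lambda>x. g x - h x) =
    vm_simple_integral \<Omega> \<mu> A g - vm_simple_integral \<Omega> \<mu> A h"
proof -
  note fin = simple_function_level_sets(1)[OF g] simple_function_level_sets(1)[OF h]
  have rep: "(\<Sum>c\<in>k ` \<Omega>. c * indicator (k -` {c} \<inter> \<Omega>) x) = k x"
    if "finite (k ` \<Omega>)" "x \<in> \<Omega>" for k :: "'a \<Rightarrow> real" and x
  proof -
    have "(\<Sum>c\<in>k ` \<Omega>. c * indicator (k -` {c} \<inter> \<Omega>) x) = (\<Sum>c\<in>k ` \<Omega>. if k x = c then c else 0)"
      using that by (intro sum.cong) (auto simp: indicator_def)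
    also have "\<dots> = k x" using that by simp
    finally show ?thesis .
  qed
  have "vm_simple_integral \<Omega> \<mu> A (\<lambda>x. g x - h x) =
      (\<Sum>i\<in>g ` \<Omega> <+> h ` \<Omega>. case_sum (\<lambda>c. c) uminus i *\<^sub>R
        \<mu> (A \<inter> case_sum (\<lambda>c. g -` {c} \<inter> \<Omega>) (\<lambda>c. h -` {c} \<inter> \<Omega>) i))"
  proof (rule vm_simple_integral_eq[OF sigma_algebra_axioms \<mu>])
    fix x assume "x \<in> \<Omega>"
    then show "g x - h x = (\<Sum>i\<in>g ` \<Omega> <+> h ` \<Omega>. case_sum (\<lambda>c. c) uminus i *
        indicator (case_sum (\<lambda>c. g -` {c} \<inter> \<Omega>) (\<lambda>c. h -` {c} \<inter> \<Omega>) i) x)"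
      by (simp only: sum.Plus[OF fin] sum.case o_def mult_minus_left sum_negf rep fin
          diff_conv_add_uminus)
  qed (use fin A simple_function_level_sets(2)[OF g] simple_function_level_sets(2)[OF h] in auto)
  then show ?thesis
    using fin by (simp add: sum.Plus sum_negf vm_simple_integral_def)
qed

lemma simple_function_sum_indicator:
  assumes "K \<subseteq> M"
  shows "simple_function (sigma \<Omega> M) (\<lambda>x. \<Sum>\<alpha>\<in>K. c \<alpha> * indicator \<alpha> x :: real)"
  using assms
  by (intro simple_function_sum simple_function_mult simple_function_const simple_function_indicator)
    (auto simp: sets_measure_of_eq)

lemma simple_integral_sum_indicator:
  assumes \<mu>: "vector_measure M \<mu>" and K: "finite K" "K \<subseteq> M"
  shows "vm_simple_integral \<Omega> \<mu> (\<Union>K) (\<lambda>x. \<Sum>\<alpha>\<in>K. c \<alpha> * indicator \<alpha> x) = (\<Sum>\<alpha>\<in>K. c \<alpha> *\<^sub>R \<mu> \<alpha>)"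
proof -
  have "vm_simple_integral \<Omega> \<mu> (\<Union>K) (\<lambda>x. \<Sum>\<alpha>\<in>K. c \<alpha> * indicator \<alpha> x) =
      (\<Sum>\<alpha>\<in>K. c \<alpha> *\<^sub>R \<mu> (\<Union>K \<inter> id \<alpha>))"
    using K by (intro vm_simple_integral_eq[OF sigma_algebra_axioms \<mu>]) auto
  also have "\<dots> = (\<Sum>\<alpha>\<in>K. c \<alpha> *\<^sub>R \<mu> \<alpha>)"
    by (intro sum.cong) (auto intro!: arg_cong[of _ _ \<mu>])
  finally show ?thesis .
qed

lemma sum_indicator_disjoint:
  fixes c :: "'b set \<Rightarrow> real"
  assumes "finite K" "disjoint K" "\<alpha> \<in> K" "x \<in> \<alpha>"
  shows "(\<Sum>\<beta>\<in>K. c \<beta> * indicator \<beta> x) = c \<alpha>"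
proof -
  have "(\<Sum>\<beta>\<in>K. c \<beta> * indicator \<beta> x) = (\<Sum>\<beta>\<in>K. if \<alpha> = \<beta> then c \<beta> else 0)"
    using assms by (intro sum.cong) (auto simp: disjoint_def indicator_def)
  then show ?thesis using assms by simp
qed

text \<open>The weights run over a cube, whose vertices correspond to values of \<open>\<mu>\<close> on unions. The additional
  set \<open>D\<close> makes the induction work: a weight \<open>c i\<close> splits the sum into a convex combination of the
  cases where \<open>B i\<close> is left out and where it is absorbed into \<open>D\<close>.\<close>

lemma weighted_sum_in_convex_hull:
  assumes \<mu>: "vector_measure M \<mu>" and I: "finite I"
    and "D \<in> M" "\<And>i. i \<in> I \<Longrightarrow> B i \<in> M" "\<And>i. i \<in> I \<Longrightarrow> D \<inter> B i = {}" "disjoint_family_on B I"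
    and "\<And>i. i \<in> I \<Longrightarrow> 0 \<le> c i" "\<And>i. i \<in> I \<Longrightarrow> c i \<le> 1"
  shows "\<mu> D + (\<Sum>i\<in>I. c i *\<^sub>R \<mu> (B i)) \<in> convex hull (\<mu> ` M)"
  using I assms(3-)
proof (induction I arbitrary: D rule: finite_induct)
  case empty
  then show ?case by (simp add: hull_inc)
next
  case (insert i I)
  let ?s = "\<Sum>i\<in>I. c i *\<^sub>R \<mu> (B i)"
  have disj: "B i \<inter> B j = {}" if "j \<in> I" for j
    using insert.prems(4) insert.hyps(2) that by (auto simp: disjoint_family_on_def)
  have "\<mu> D + ?s \<in> convex hull (\<mu> ` M)"
    using insert.prems by (intro insert.IH) (auto simp: disjoint_family_on_def)
  moreover have "\<mu> (D \<union> B i) + ?s \<in> convex hull (\<mu> ` M)"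
    using insert.prems disj
    by (intro insert.IH) (auto simp: disjoint_family_on_def Int_Un_distrib2)
  ultimately have "(1 - c i) *\<^sub>R (\<mu> D + ?s) + c i *\<^sub>R (\<mu> (D \<union> B i) + ?s) \<in> convex hull (\<mu> ` M)"
    using insert.prems by (intro convexD[OF convex_convex_hull]) auto
  also have "(1 - c i) *\<^sub>R (\<mu> D + ?s) + c i *\<^sub>R (\<mu> (D \<union> B i) + ?s) =
      \<mu> D + (\<Sum>i\<in>insert i I. c i *\<^sub>R \<mu> (B i))"
    using insert.hyps insert.prems
    by (simp add: vector_measure_Un[OF sigma_algebra_axioms \<mu>] algebra_simps)
  finally show ?case .
qed

text \<open>If \<open>\<bar>h\<bar> \<le> 1 / t\<close>, the positive and the negative part of \<open>t * h\<close> have values in \<open>[0, 1]\<close>, so both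
  integrals lie in the convex hull of the range, which is absorbed by \<open>t *\<^sub>R V\<close> for large \<open>t\<close>.\<close>

lemma small_simple_integral:
  assumes \<mu>: "vector_measure M \<mu>" "convexly_bounded M \<mu>" and U: "open U" "0 \<in> U"
  obtains \<eta> :: real where "\<eta> > 0"
    "\<And>h C. simple_function (sigma \<Omega> M) h \<Longrightarrow> C \<in> M \<Longrightarrow> (\<And>x. x \<in> C \<Longrightarrow> \<bar>h x\<bar> \<le> \<eta>) \<Longrightarrow>
      vm_simple_integral \<Omega> \<mu> C h \<in> U"
proof -
  obtain V where V: "open V" "0 \<in> V" "\<And>x y. x \<in> V \<Longrightarrow> y \<in> V \<Longrightarrow> x - y \<in> U"
    using zero_neighbourhood_arith[OF U] by metis
  obtain s where s: "s > 0" "\<And>t. t > s \<Longrightarrow> convex hull (\<mu> ` M) \<subseteq> (\<lambda>u. t *\<^sub>R u) ` V"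
    using \<mu>(2) V unfolding convexly_bounded_def tvs_bounded_def by metis
  define t where "t = s + 1"
  have t: "t > 0" using s(1) by (simp add: t_def)
  have scaled: "(1 / t) *\<^sub>R y \<in> V" if y: "y \<in> convex hull (\<mu> ` M)" for y
  proof -
    obtain u where "u \<in> V" "y = t *\<^sub>R u" using s(2)[of t] y by (auto simp: t_def)
    then show ?thesis using t by simp
  qed
  have \<mu>0: "\<mu> {} = 0" by (rule vector_measure_empty[OF sigma_algebra_axioms \<mu>(1)])
  show ?thesis
  proof (rule that[of "1 / t"])
    fix h :: "'a \<Rightarrow> real" and C
    assume h: "simple_function (sigma \<Omega> M) h" and C: "C \<in> M" and small: "\<And>x. x \<in> C \<Longrightarrow> \<bar>h x\<bar> \<le> 1 / t"
    define E where "E c = C \<inter> (h -` {c} \<inter> \<Omega>)" for c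
    have "C \<subseteq> \<Omega>" using C sets_into_space by blast
    then have fin: "finite (h ` C)"
      using simple_function_level_sets(1)[OF h] by (meson finite_subset image_mono)
    have hull: "(\<Sum>c\<in>h ` C. w c *\<^sub>R \<mu> (E c)) \<in> convex hull (\<mu> ` M)"
      if w: "\<And>c. c \<in> h ` C \<Longrightarrow> 0 \<le> w c \<and> w c \<le> 1" for w
    proof -
      have "E c \<in> M" for c using C simple_function_level_sets(2)[OF h] by (auto simp: E_def)
      moreover have "disjoint_family_on E (h ` C)"
        by (auto simp: E_def disjoint_family_on_def)
      ultimately have "\<mu> {} + (\<Sum>c\<in>h ` C. w c *\<^sub>R \<mu> (E c)) \<in> convex hull (\<mu> ` M)"
        using w by (intro weighted_sum_in_convex_hull[OF \<mu>(1) fin]) auto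
      then show ?thesis by (simp add: \<mu>0)
    qed
    have "\<bar>t * c\<bar> \<le> 1" if "c \<in> h ` C" for c
      using small that t by (auto simp: abs_mult field_simps)
    then have "(1 / t) *\<^sub>R (\<Sum>c\<in>h ` C. max 0 (t * c) *\<^sub>R \<mu> (E c)) -
        (1 / t) *\<^sub>R (\<Sum>c\<in>h ` C. max 0 (- (t * c)) *\<^sub>R \<mu> (E c)) \<in> U"
      by (intro V(3) scaled hull) force+
    also have "(1 / t) *\<^sub>R (\<Sum>c\<in>h ` C. max 0 (t * c) *\<^sub>R \<mu> (E c)) -
        (1 / t) *\<^sub>R (\<Sum>c\<in>h ` C. max 0 (- (t * c)) *\<^sub>R \<mu> (E c)) =
        (\<Sum>c\<in>h ` C. ((1 / t) * (max 0 (t * c) - max 0 (- (t * c)))) *\<^sub>R \<mu> (E c))"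
      by (simp add: scaleR_sum_right sum_subtractf scaleR_diff_left right_diff_distrib)
    also have "\<dots> = (\<Sum>c\<in>h ` C. c *\<^sub>R \<mu> (E c))"
    proof (rule sum.cong[OF refl])
      fix c
      have "max 0 (t * c) - max 0 (- (t * c)) = t * c" by linarith
      then have "(1 / t) * (max 0 (t * c) - max 0 (- (t * c))) = c" using t by simp
      then show "((1 / t) * (max 0 (t * c) - max 0 (- (t * c)))) *\<^sub>R \<mu> (E c) = c *\<^sub>R \<mu> (E c)"
        by presburger
    qed
    also have "\<dots> = (\<Sum>c\<in>h ` \<Omega>. c *\<^sub>R \<mu> (E c))"
    proof (rule sum.mono_neutral_left)
      show "\<forall>c\<in>h ` \<Omega> - h ` C. c *\<^sub>R \<mu> (E c) = 0"
      proof
        fix c assume "c \<in> h ` \<Omega> - h ` C"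
        then have "c \<notin> h ` C" by simp
        then have "E c = {}" unfolding E_def by blast
        then show "c *\<^sub>R \<mu> (E c) = 0" using \<mu>0 by simp
      qed
    qed (use simple_function_level_sets(1)[OF h] \<open>C \<subseteq> \<Omega>\<close> in auto)
    finally show "vm_simple_integral \<Omega> \<mu> C h \<in> U" by (simp add: vm_simple_integral_def E_def)
  qed (use t in simp)
qed

end


lemma countable_partitionsD:
  assumes "P \<in> countable_partitions H A"
  shows "countable P" "P \<subseteq> H" "disjoint P" "\<Union>P = A" "{} \<notin> P"
  using assms by (auto simp: countable_partitions_def partition_on_def)


section \<open>Pointwise approximation controls the integral\<close>

text \<open>One approximating sequence is kept fixed, together with the limits \<open>\<nu>\<close> of its integrals, so that
  the independence of the integral from the sequence is not presupposed.\<close>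

locale bds_approximation = sigma_algebra \<Omega> H
  for \<Omega> :: "'a set" and H +
  fixes \<mu> :: "'a set \<Rightarrow> 'x::hausdorff_tvs" and f :: "'a \<Rightarrow> real" and s :: "nat \<Rightarrow> 'a \<Rightarrow> real"
    and N :: "'a set" and \<nu> :: "'a set \<Rightarrow> 'x"
  assumes \<mu>: "vector_measure H \<mu>" "convexly_bounded H \<mu>"
    and simple: "simple_function (sigma \<Omega> H) (s n)"
    and N: "vm_null H \<mu> N"
    and pointwise: "x \<in> \<Omega> - N \<Longrightarrow> (\<lambda>n. s n x) \<longlonglongrightarrow> f x"
    and integrals: "A \<in> H \<Longrightarrow> (\<lambda>n. vm_simple_integral \<Omega> \<mu> A (s n)) \<longlonglongrightarrow> \<nu> A"
begin

abbreviation "simp_fun \<equiv> simple_function (sigma \<Omega> H)"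

abbreviation "\<I> \<equiv> vm_simple_integral \<Omega> \<mu>"

lemma integral_vector_measure: "vector_measure H \<nu>"
  using simple_integral_vector_measure[OF \<mu>(1) simple] integrals
  by (rule nikodym_convergence)

lemma N_sets: "N \<in> H"
  using N by (simp add: vm_null_def)

lemma measure_in_N: "B \<in> H \<Longrightarrow> B \<subseteq> N \<Longrightarrow> \<mu> B = 0"
  using N by (simp add: vm_null_def)

lemma simple_integral_in_N:
  assumes "B \<in> H" "B \<subseteq> N" "simp_fun h"
  shows "\<I> B h = 0"
  unfolding vm_simple_integral_def
proof (intro sum.neutral ballI)
  fix c
  have "\<mu> (B \<inter> (h -` {c} \<inter> \<Omega>)) = 0"
    using assms simple_function_level_sets(2)[OF assms(3)] by (intro measure_in_N) auto
  then show "c *\<^sub>R \<mu> (B \<inter> (h -` {c} \<inter> \<Omega>)) = 0" by simp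
qed

lemma integral_in_N:
  assumes "B \<in> H" "B \<subseteq> N"
  shows "\<nu> B = 0"
  using integrals[OF assms(1)] simple_integral_in_N[OF assms simple]
  by (simp add: LIMSEQ_const_iff)

lemma uniform_approximation:
  assumes U: "open U" "0 \<in> U"
  obtains \<eta> :: real where "\<eta> > 0"
    "\<And>h C. simp_fun h \<Longrightarrow> C \<in> H \<Longrightarrow> (\<And>x. x \<in> C - N \<Longrightarrow> \<bar>f x - h x\<bar> \<le> \<eta>) \<Longrightarrow> \<I> C h - \<nu> C \<in> U"
proof -
  obtain V where V: "open V" "0 \<in> V" "closure V \<subseteq> U"
    using zero_neighbourhood_arith[OF U] by metis
  obtain \<eta> :: real where \<eta>: "\<eta> > 0"
    "\<And>h C. simp_fun h \<Longrightarrow> C \<in> H \<Longrightarrow> (\<And>x. x \<in> C \<Longrightarrow> \<bar>h x\<bar> \<le> \<eta>) \<Longrightarrow> \<I> C h \<in> V"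
    using small_simple_integral[OF \<mu> V(1,2)] by metis
  show ?thesis
  proof (rule that[of "\<eta> / 2"])
    fix h C assume h: "simp_fun h" and C: "C \<in> H"
      and near: "\<And>x. x \<in> C - N \<Longrightarrow> \<bar>f x - h x\<bar> \<le> \<eta> / 2"
    define \<rho> where "\<rho> A = \<I> A h - \<nu> A" for A
    have \<rho>: "vector_measure H \<rho>"
      unfolding \<rho>_def by (intro vector_measure_diff integral_vector_measure simple_integral_vector_measure[OF \<mu>(1) h])
    (* D m is the part of C - N on which s n stays within \<eta> of h from n = m on. *)
    define far where "far n = (\<lambda>x. h x - s n x) -` {y. \<bar>y\<bar> > \<eta>} \<inter> \<Omega>" for n
    define D where "D m = (C - N) - (\<Union>n\<in>{m..}. far n)" for m
    have simple_diff: "simp_fun (\<lambda>x. h x - s n x)" for n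
      using simple_function_diff[OF h simple[of n]] by simp
    have farH: "far n \<in> H" for n
      unfolding far_def by (rule simple_function_level_sets(2)[OF simple_diff])
    have DH: "D m \<in> H" for m
      using C N_sets farH unfolding D_def by (intro Diff countable_UN') auto
    have C\<Omega>: "C \<subseteq> \<Omega>" using C sets_into_space by blast
    have D\<rho>: "\<rho> (D m) \<in> closure V" for m
    proof -
      have "(\<lambda>n. \<I> (D m) h - \<I> (D m) (s n)) \<longlonglongrightarrow> \<rho> (D m)"
        unfolding \<rho>_def by (intro tendsto_diff tendsto_const integrals DH)
      moreover have "\<I> (D m) h - \<I> (D m) (s n) \<in> V" if "n \<ge> m" for n
      proof -
        have "\<bar>h x - s n x\<bar> \<le> \<eta>" if "x \<in> D m" for x
        proof -
          have "x \<in> \<Omega>" "x \<notin> far n" using that \<open>n \<ge> m\<close> C\<Omega> unfolding D_def by auto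
          then show ?thesis by (simp add: far_def)
        qed
        then have "\<I> (D m) (\<lambda>x. h x - s n x) \<in> V" by (rule \<eta>(2)[OF simple_diff DH])
        then show ?thesis by (simp add: simple_integral_diff[OF \<mu>(1) DH h simple])
      qed
      then have "\<forall>\<^sub>F n in sequentially. \<I> (D m) h - \<I> (D m) (s n) \<in> closure V"
        unfolding eventually_sequentially by (intro exI[of _ m] allI impI subsetD[OF closure_subset])
      ultimately show ?thesis by (intro Lim_in_closed_set[OF closed_closure]) simp_all
    qed
    have "(\<lambda>m. \<rho> (D m)) \<longlonglongrightarrow> \<rho> (\<Union>m. D m)"
      using DH by (intro vector_measure_incseq[OF \<rho>]) (auto simp: incseq_def D_def)
    moreover have "(\<Union>m. D m) = C - N"
    proof (intro equalityI subsetI)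
      fix x assume x: "x \<in> C - N"
      have "(\<lambda>n. \<bar>h x - s n x\<bar>) \<longlonglongrightarrow> \<bar>h x - f x\<bar>"
        using x C\<Omega> by (intro tendsto_intros pointwise) auto
      moreover have "\<bar>h x - f x\<bar> < \<eta>" using near[OF x] \<eta>(1) by (simp add: abs_minus_commute)
      ultimately have "\<forall>\<^sub>F n in sequentially. \<bar>h x - s n x\<bar> < \<eta>" by (rule order_tendstoD)
      then obtain m where "\<And>n. n \<ge> m \<Longrightarrow> \<bar>h x - s n x\<bar> < \<eta>" by (auto simp: eventually_sequentially)
      then have "x \<notin> far n" if "n \<ge> m" for n using that by (force simp: far_def)
      then have "x \<in> D m" using x by (simp add: D_def)
      then show "x \<in> (\<Union>m. D m)" by blast
    qed (auto simp: D_def)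
    ultimately have lim: "(\<lambda>m. \<rho> (D m)) \<longlonglongrightarrow> \<rho> (C - N)" by simp
    have "\<rho> (C - N) \<in> closure V"
      by (intro Lim_in_closed_set[OF closed_closure _ _ lim]) (simp_all add: D\<rho>)
    moreover have "\<rho> (C \<inter> N) = 0"
      using integral_in_N[of "C \<inter> N"] simple_integral_in_N[of "C \<inter> N" h] Int[OF C N_sets] h
      by (simp add: \<rho>_def)
    ultimately have "\<rho> C \<in> closure V"
      using vector_measure_split[OF \<rho> C N_sets] by simp
    then show "\<I> C h - \<nu> C \<in> U" unfolding \<rho>_def by (rule subsetD[OF V(3)])
  qed (use \<eta>(1) in simp)
qed


section \<open>Sums over countable partitions\<close>

text \<open>The partial sum is the integral of the step function with value \<open>c \<alpha>\<close> on \<open>\<alpha>\<close>.\<close>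

lemma partition_sums_near_integral:
  assumes U: "open U" "0 \<in> U"
  shows "\<exists>\<eta>>0. \<forall>K c. finite K \<and> K \<subseteq> H \<and> disjoint K \<and> (\<forall>\<alpha>\<in>K. \<forall>x\<in>\<alpha> - N. \<bar>f x - c \<alpha>\<bar> \<le> \<eta>) \<longrightarrow>
    (\<Sum>\<alpha>\<in>K. c \<alpha> *\<^sub>R \<mu> \<alpha>) - sum \<nu> K \<in> U"
proof -
  obtain \<eta> :: real where \<eta>: "\<eta> > 0"
    "\<And>h C. simp_fun h \<Longrightarrow> C \<in> H \<Longrightarrow> (\<And>x. x \<in> C - N \<Longrightarrow> \<bar>f x - h x\<bar> \<le> \<eta>) \<Longrightarrow> \<I> C h - \<nu> C \<in> U"
    using uniform_approximation[OF U] by metis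
  show ?thesis
  proof (intro exI[of _ \<eta>] conjI \<eta>(1) allI impI; elim conjE)
    fix K c assume K: "finite K" "K \<subseteq> H" "disjoint K"
      and near: "\<forall>\<alpha>\<in>K. \<forall>x\<in>\<alpha> - N. \<bar>f x - c \<alpha>\<bar> \<le> \<eta>"
    have "\<I> (\<Union>K) (\<lambda>x. \<Sum>\<alpha>\<in>K. c \<alpha> * indicator \<alpha> x) - \<nu> (\<Union>K) \<in> U"
    proof (rule \<eta>(2))
      fix x assume "x \<in> \<Union>K - N"
      then obtain \<alpha> where \<alpha>: "\<alpha> \<in> K" "x \<in> \<alpha> - N" by blast
      then show "\<bar>f x - (\<Sum>\<alpha>\<in>K. c \<alpha> * indicator \<alpha> x)\<bar> \<le> \<eta>"
        using near[rule_format, OF \<alpha>] sum_indicator_disjoint[OF K(1,3) \<alpha>(1), of x c] \<alpha>(2) by simp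
    next
      show "simp_fun (\<lambda>x. \<Sum>\<alpha>\<in>K. c \<alpha> * indicator \<alpha> x)"
        by (rule simple_function_sum_indicator[OF K(2)])
      show "\<Union>K \<in> H" using K by auto
    qed
    then show "(\<Sum>\<alpha>\<in>K. c \<alpha> *\<^sub>R \<mu> \<alpha>) - sum \<nu> K \<in> U"
      by (simp only: simple_integral_sum_indicator[OF \<mu>(1) K(1,2)] vector_measure_sum[OF integral_vector_measure K])
  qed
qed

text \<open>A genuinely measurable version of \<open>f\<close>: the functions \<open>s n\<close>, cut off on \<open>N\<close>, converge to it
  everywhere.\<close>

definition null_modification :: "'a \<Rightarrow> real" where
  "null_modification x = (if x \<in> N then 0 else f x)"

lemma null_modification_measurable: "null_modification \<in> borel_measurable (sigma \<Omega> H)"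
proof (rule borel_measurable_LIMSEQ_real)
  show "(\<lambda>n. indicator (\<Omega> - N) x * s n x) \<longlonglongrightarrow> null_modification x"
    if "x \<in> space (sigma \<Omega> H)" for x
    using that pointwise[of x] by (auto simp: null_modification_def indicator_def)
  show "(\<lambda>x. indicator (\<Omega> - N) x * s n x) \<in> borel_measurable (sigma \<Omega> H)" for n
    using N_sets
    by (intro borel_measurable_times borel_measurable_simple_function simple borel_measurable_indicator)
      auto
qed

text \<open>The step function with values \<open>c \<alpha>\<close> may take infinitely many values, but its difference from \<open>f\<close> is
  bounded by \<open>\<epsilon>\<close>. Rounding the difference down to a multiple of \<open>\<eta>\<close> therefore gives a simple
  function, which may jump inside a member of the partition.\<close>

lemma simple_remainder:
  assumes P: "countable P" "P \<subseteq> H" "disjoint P" and \<eta>: "\<eta> > 0"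
    and near: "\<And>\<alpha> x. \<alpha> \<in> P \<Longrightarrow> x \<in> \<alpha> - N \<Longrightarrow> \<bar>f x - c \<alpha>\<bar> \<le> \<epsilon>"
  obtains r where "simp_fun r"
    "\<And>\<alpha> x. \<alpha> \<in> P \<Longrightarrow> x \<in> \<alpha> - N \<Longrightarrow> \<bar>f x - (c \<alpha> - r x)\<bar> \<le> \<eta>"
proof -
  define q where "q \<alpha> x = \<eta> * of_int \<lfloor>(c \<alpha> - f x) / \<eta>\<rfloor>" for \<alpha> x
  define r where "r x = (if \<exists>\<alpha>\<in>P. x \<in> \<alpha> - N then q (THE \<alpha>. \<alpha> \<in> P \<and> x \<in> \<alpha>) x else 0)" for x
  have r_eq: "r x = q \<alpha> x" if "\<alpha> \<in> P" "x \<in> \<alpha> - N" for \<alpha> x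
  proof -
    have "(THE \<alpha>. \<alpha> \<in> P \<and> x \<in> \<alpha>) = \<alpha>"
      using that P(3) by (intro the_equality) (auto simp: disjoint_def)
    then show ?thesis using that by (auto simp: r_def)
  qed
  have outside: "r x = 0" if "x \<notin> \<Union>P - N" for x using that by (auto simp: r_def)
  have "simp_fun r"
    unfolding simple_function_def
  proof (intro conjI ballI)
    let ?V = "(\<lambda>j. \<eta> * of_int j) ` {\<lfloor>- \<epsilon> / \<eta>\<rfloor>..\<lfloor>\<epsilon> / \<eta>\<rfloor>} \<union> {0}"
    have "r x \<in> ?V" for x
    proof (cases "x \<in> \<Union>P - N")
      case True
      then obtain \<alpha> where \<alpha>: "\<alpha> \<in> P" "x \<in> \<alpha> - N" by blast
      have "- \<epsilon> \<le> c \<alpha> - f x" "c \<alpha> - f x \<le> \<epsilon>" using near[OF \<alpha>] by linarith+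
      then have "- \<epsilon> / \<eta> \<le> (c \<alpha> - f x) / \<eta>" "(c \<alpha> - f x) / \<eta> \<le> \<epsilon> / \<eta>"
        using \<eta> by (simp_all only: divide_right_mono less_imp_le)
      then have "\<lfloor>(c \<alpha> - f x) / \<eta>\<rfloor> \<in> {\<lfloor>- \<epsilon> / \<eta>\<rfloor>..\<lfloor>\<epsilon> / \<eta>\<rfloor>}"
        by (simp only: atLeastAtMost_iff floor_mono)
      then show ?thesis unfolding r_eq[OF \<alpha>] q_def by blast
    qed (simp add: outside)
    then show "finite (r ` space (sigma \<Omega> H))" 
      by (intro finite_subset[OF image_subsetI, of _ r ?V]) simp_all
  next
    fix v
    define Q where "Q \<alpha> = {x\<in>\<Omega>. \<eta> * of_int \<lfloor>(c \<alpha> - null_modification x) / \<eta>\<rfloor> = v} \<inter> (\<alpha> - N)" for \<alpha>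
    have QH: "Q \<alpha> \<in> H" if "\<alpha> \<in> P" for \<alpha>
    proof -
      have "(\<lambda>x. \<eta> * of_int \<lfloor>(c \<alpha> - null_modification x) / \<eta>\<rfloor>) \<in> borel_measurable (sigma \<Omega> H)"
        using null_modification_measurable by measurable
      then have "(\<lambda>x. \<eta> * of_int \<lfloor>(c \<alpha> - null_modification x) / \<eta>\<rfloor>) -` {v} \<inter> space (sigma \<Omega> H) \<in> sets (sigma \<Omega> H)"
        by (rule measurable_sets) simp
      then have "{x\<in>\<Omega>. \<eta> * of_int \<lfloor>(c \<alpha> - null_modification x) / \<eta>\<rfloor> = v} \<in> H"
        by (simp add: vimage_def Collect_conj_eq Int_commute)
      moreover have "\<alpha> - N \<in> H" using that P(2) N_sets by auto
      ultimately show ?thesis unfolding Q_def by (rule Int)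
    qed
    have Q_iff: "x \<in> Q \<alpha> \<longleftrightarrow> r x = v" if "\<alpha> \<in> P" "x \<in> \<alpha> - N" for \<alpha> x
    proof -
      have "x \<in> \<Omega>" using that P(2) sets_into_space by blast
      then show ?thesis using that by (simp add: Q_def r_eq q_def null_modification_def)
    qed
    have Q_sub: "Q \<alpha> \<subseteq> \<alpha> - N" "Q \<alpha> \<subseteq> \<Omega>" for \<alpha> by (auto simp: Q_def)
    have "r -` {v} \<inter> \<Omega> = (\<Union>\<alpha>\<in>P. Q \<alpha>) \<union> (if v = 0 then \<Omega> - (\<Union>P - N) else {})"
    proof (intro equalityI subsetI)
      fix x assume x: "x \<in> r -` {v} \<inter> \<Omega>"
      show "x \<in> (\<Union>\<alpha>\<in>P. Q \<alpha>) \<union> (if v = 0 then \<Omega> - (\<Union>P - N) else {})"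
      proof (cases "x \<in> \<Union>P - N")
        case True
        then obtain \<alpha> where \<alpha>: "\<alpha> \<in> P" "x \<in> \<alpha> - N" by blast
        then have "x \<in> Q \<alpha>" using Q_iff x by blast
        then show ?thesis using \<alpha>(1) by blast
      qed (use x outside in auto)
    next
      fix x assume x: "x \<in> (\<Union>\<alpha>\<in>P. Q \<alpha>) \<union> (if v = 0 then \<Omega> - (\<Union>P - N) else {})"
      show "x \<in> r -` {v} \<inter> \<Omega>"
      proof (cases "x \<in> (\<Union>\<alpha>\<in>P. Q \<alpha>)")
        case True
        then obtain \<alpha> where \<alpha>: "\<alpha> \<in> P" "x \<in> Q \<alpha>" by blast
        then have "x \<in> \<alpha> - N" "x \<in> \<Omega>" using Q_sub by blast+
        then show ?thesis using Q_iff[OF \<alpha>(1)] \<alpha>(2) by blast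
      qed (use x outside in \<open>auto split: if_splits\<close>)
    qed
    also have "\<dots> \<in> H"
    proof (rule Un)
      show "(\<Union>\<alpha>\<in>P. Q \<alpha>) \<in> H" using QH P(1) by (intro countable_UN') auto
      have "\<Union>P \<in> H" using P by (intro countable_Union)
      then show "(if v = 0 then \<Omega> - (\<Union>P - N) else {}) \<in> H" using N_sets by auto
    qed
    finally have "r -` {v} \<inter> \<Omega> \<in> H" .
    then show "r -` {v} \<inter> space (sigma \<Omega> H) \<in> sets (sigma \<Omega> H)" by simp
  qed
  moreover have "\<bar>f x - (c \<alpha> - r x)\<bar> \<le> \<eta>" if "\<alpha> \<in> P" "x \<in> \<alpha> - N" for \<alpha> x
  proof -
    let ?y = "(c \<alpha> - f x) / \<eta>"
    have y: "\<eta> * ?y = c \<alpha> - f x" using \<eta> by simp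
    have "f x - (c \<alpha> - r x) = \<eta> * (of_int \<lfloor>?y\<rfloor> - ?y)"
      by (simp only: r_eq[OF that] q_def right_diff_distrib[of \<eta>] y)
    moreover have "\<bar>of_int \<lfloor>?y\<rfloor> - ?y\<bar> \<le> 1" by linarith
    ultimately show ?thesis using \<eta> by (simp add: abs_mult)
  qed
  ultimately show ?thesis using that by blast
qed

text \<open>A finite partial sum over \<open>K\<close> is the integral over \<open>\<Union>K\<close> of a step function \<open>h\<close>. As \<open>h - r\<close> is
  uniformly close to \<open>f\<close>, the sum is close to \<open>\<nu> (\<Union>K) + \<I> (\<Union>K) r\<close>, the value at \<open>\<Union>K\<close> of a vector
  measure that depends on neither \<open>K\<close> nor \<open>h\<close>. This is where \<open>r\<close> being one function for the whole
  partition matters.\<close>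

lemma partition_sum_summable:
  assumes complete: "sequentially_complete TYPE('x)"
    and P: "countable P" "P \<subseteq> H" "disjoint P"
    and near: "\<And>\<alpha> x. \<alpha> \<in> P \<Longrightarrow> x \<in> \<alpha> - N \<Longrightarrow> \<bar>f x - c \<alpha>\<bar> \<le> \<epsilon>"
  shows "(\<lambda>\<alpha>. c \<alpha> *\<^sub>R \<mu> \<alpha>) summable_on P"
proof (rule summable_on_if_Cauchy[OF complete P(1)])
  fix U :: "'x set" assume U: "open U" "0 \<in> U"
  obtain V where V: "open V" "0 \<in> V" "\<And>x y. x \<in> V \<Longrightarrow> y \<in> V \<Longrightarrow> x + y \<in> U"
    using zero_neighbourhood_arith[OF U] by metis
  obtain \<eta> :: real where \<eta>: "\<eta> > 0"
    "\<And>h C. simp_fun h \<Longrightarrow> C \<in> H \<Longrightarrow> (\<And>x. x \<in> C - N \<Longrightarrow> \<bar>f x - h x\<bar> \<le> \<eta>) \<Longrightarrow> \<I> C h - \<nu> C \<in> V"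
    using uniform_approximation[OF V(1,2)] by metis
  obtain r where r: "simp_fun r"
    "\<And>\<alpha> x. \<alpha> \<in> P \<Longrightarrow> x \<in> \<alpha> - N \<Longrightarrow> \<bar>f x - (c \<alpha> - r x)\<bar> \<le> \<eta>"
    using simple_remainder[OF P \<eta>(1), of c \<epsilon>] near by metis
  have tail: "vector_measure H (\<lambda>A. \<nu> A + \<I> A r)"
    by (intro vector_measure_add integral_vector_measure simple_integral_vector_measure[OF \<mu>(1) r(1)])
  obtain J where J: "finite J" "J \<subseteq> P"
    "\<forall>K. finite K \<and> K \<subseteq> P - J \<longrightarrow> \<nu> (\<Union>K) + \<I> (\<Union>K) r \<in> V"
    using vector_measure_Cauchy[OF tail P(2,3) V(1,2)] by (elim exE conjE)
  have "(\<Sum>\<alpha>\<in>K. c \<alpha> *\<^sub>R \<mu> \<alpha>) \<in> U" if K: "finite K" "K \<subseteq> P - J" for K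
  proof -
    have KP: "K \<subseteq> P" "K \<subseteq> H" "disjoint K" using K P pairwise_subset[OF P(3)] by auto
    have C: "\<Union>K \<in> H" using K(1) KP(2) by auto
    define h where "h x = (\<Sum>\<alpha>\<in>K. c \<alpha> * indicator \<alpha> x)" for x
    have h: "simp_fun h" unfolding h_def by (rule simple_function_sum_indicator[OF KP(2)])
    have "\<I> (\<Union>K) (\<lambda>x. h x - r x) - \<nu> (\<Union>K) \<in> V"
    proof (rule \<eta>(2)[OF _ C])
      show "simp_fun (\<lambda>x. h x - r x)" using simple_function_diff[OF h r(1)] by simp
      fix x assume "x \<in> \<Union>K - N"
      then obtain \<alpha> where \<alpha>: "\<alpha> \<in> K" "x \<in> \<alpha> - N" by blast
      then have "h x = c \<alpha>"
        using sum_indicator_disjoint[OF K(1) KP(3) \<alpha>(1), of x c] \<alpha>(2) by (simp add: h_def)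
      then show "\<bar>f x - (h x - r x)\<bar> \<le> \<eta>" using r(2) \<alpha> KP(1) by auto
    qed
    then have "(\<I> (\<Union>K) (\<lambda>x. h x - r x) - \<nu> (\<Union>K)) + (\<nu> (\<Union>K) + \<I> (\<Union>K) r) \<in> U"
      using J(3)[rule_format, OF conjI[OF K]] by (rule V(3))
    moreover have "\<I> (\<Union>K) h = (\<Sum>\<alpha>\<in>K. c \<alpha> *\<^sub>R \<mu> \<alpha>)"
      unfolding h_def by (rule simple_integral_sum_indicator[OF \<mu>(1) K(1) KP(2)])
    ultimately show ?thesis by (simp add: simple_integral_diff[OF \<mu>(1) C h r(1)])
  qed
  then show "\<exists>J. finite J \<and> J \<subseteq> P \<and> (\<forall>K. finite K \<and> K \<subseteq> P - J \<longrightarrow> (\<Sum>\<alpha>\<in>K. c \<alpha> *\<^sub>R \<mu> \<alpha>) \<in> U)"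
    using J(1,2) by metis
qed

text \<open>The level sets of \<open>f / \<epsilon>\<close> rounded down to integers, with \<open>A \<inter> N\<close> as one further member.\<close>

lemma oscillation_partition:
  assumes A: "A \<in> H" and \<epsilon>: "\<epsilon> > 0"
  obtains P where "P \<in> countable_partitions H A"
    "\<And>\<alpha> x y. \<alpha> \<in> P \<Longrightarrow> \<not> \<alpha> \<subseteq> N \<Longrightarrow> x \<in> \<alpha> \<Longrightarrow> y \<in> \<alpha> \<Longrightarrow> \<bar>f x - f y\<bar> \<le> \<epsilon>"
proof -
  have A\<Omega>: "A \<subseteq> \<Omega>" using A sets_into_space by blast
  define Q where "Q j = {x\<in>A - N. \<lfloor>f x / \<epsilon>\<rfloor> = j}" for j
  define P where "P = insert (A \<inter> N) (range Q) - {{}}"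
  have QH: "Q j \<in> H" for j
  proof -
    have "(\<lambda>x. of_int \<lfloor>null_modification x / \<epsilon>\<rfloor> :: real) \<in> borel_measurable (sigma \<Omega> H)"
      using null_modification_measurable by measurable
    then have "(\<lambda>x. of_int \<lfloor>null_modification x / \<epsilon>\<rfloor> :: real) -` {of_int j} \<inter> space (sigma \<Omega> H)
        \<in> sets (sigma \<Omega> H)"
      by (rule measurable_sets) simp
    then have "{x\<in>\<Omega>. \<lfloor>null_modification x / \<epsilon>\<rfloor> = j} \<in> H"
      by (simp add: vimage_def Collect_conj_eq Int_commute)
    moreover have "Q j = {x\<in>\<Omega>. \<lfloor>null_modification x / \<epsilon>\<rfloor> = j} \<inter> (A - N)"
      using A\<Omega> by (auto simp: Q_def null_modification_def)
    ultimately show ?thesis using A N_sets by auto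
  qed
  have "P \<in> countable_partitions H A"
    unfolding countable_partitions_def
  proof (intro CollectI conjI partition_onI)
    show "\<Union>P = A"
    proof (intro equalityI subsetI)
      fix x assume x: "x \<in> A"
      have "x \<in> A \<inter> N \<or> x \<in> Q \<lfloor>f x / \<epsilon>\<rfloor>" using x by (auto simp: Q_def)
      then show "x \<in> \<Union>P" unfolding P_def by blast
    qed (auto simp: P_def Q_def)
    show "disjnt p q" if "p \<in> P" "q \<in> P" "p \<noteq> q" for p q
      using that by (auto simp: P_def Q_def disjnt_def)
    show "P \<subseteq> H" using QH A N_sets by (auto simp: P_def)
    show "countable P" by (auto simp: P_def)
  qed (simp add: P_def)
  moreover have "\<bar>f x - f y\<bar> \<le> \<epsilon>" if "\<alpha> \<in> P" "\<not> \<alpha> \<subseteq> N" "x \<in> \<alpha>" "y \<in> \<alpha>" for \<alpha> x y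
  proof -
    have "\<lfloor>f x / \<epsilon>\<rfloor> = \<lfloor>f y / \<epsilon>\<rfloor>" using that by (auto simp: P_def Q_def)
    then have "\<bar>f x / \<epsilon> - f y / \<epsilon>\<bar> \<le> 1" by linarith
    then have "\<bar>(f x - f y) / \<epsilon>\<bar> \<le> 1" by (simp add: diff_divide_distrib)
    then show ?thesis using \<epsilon> by (simp add: abs_divide)
  qed
  ultimately show ?thesis using that by blast
qed

lemma refined_choice_near:
  assumes P0: "\<And>\<alpha> x y. \<alpha> \<in> P0 \<Longrightarrow> \<not> \<alpha> \<subseteq> N \<Longrightarrow> x \<in> \<alpha> \<Longrightarrow> y \<in> \<alpha> \<Longrightarrow> \<bar>f x - f y\<bar> \<le> \<epsilon>"
    and P: "P \<in> countable_partitions H A" "refines A P P0" and \<delta>: "choice_function \<Omega> \<delta>"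
    and \<alpha>: "\<alpha> \<in> P" "x \<in> \<alpha> - N"
  shows "\<bar>f x - f (\<delta> \<alpha>)\<bar> \<le> \<epsilon>"
proof -
  obtain \<beta> where \<beta>: "\<beta> \<in> P0" "\<alpha> \<subseteq> \<beta>" using P(2) \<alpha>(1) unfolding refines_def by blast
  have "\<alpha> \<subseteq> \<Omega>" using countable_partitionsD(2)[OF P(1)] \<alpha>(1) sets_into_space by blast
  then have "\<delta> \<alpha> \<in> \<alpha>" using \<delta> \<alpha>(2) unfolding choice_function_def by blast
  then show ?thesis using P0[OF \<beta>(1)] \<beta>(2) \<alpha>(2) by blast
qed

text \<open>Oscillation at most \<open>1\<close> suffices for summability. For the value, the difference between the partial
  sums of \<open>f (\<delta> \<alpha>) *\<^sub>R \<mu> \<alpha>\<close> and of \<open>\<nu>\<close> stays in a small neighbourhood, and so does its limit up to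
  closure.\<close>

theorem has_sstar_integral_limit:
  assumes complete: "sequentially_complete TYPE('x)" and A: "A \<in> H"
  shows "has_sstar_integral \<Omega> H \<mu> A f (\<nu> A)"
  unfolding has_sstar_integral_def
proof (intro conjI allI impI; (elim conjE)?)
  have summable: "(\<lambda>\<alpha>. f (\<delta> \<alpha>) *\<^sub>R \<mu> \<alpha>) summable_on P"
    if "\<And>\<alpha> x. \<alpha> \<in> P \<Longrightarrow> x \<in> \<alpha> - N \<Longrightarrow> \<bar>f x - f (\<delta> \<alpha>)\<bar> \<le> \<epsilon>" "P \<in> countable_partitions H A" for P \<delta> \<epsilon>
    using that(1) by (rule partition_sum_summable[OF complete countable_partitionsD(1-3)[OF that(2)]])
  {
    obtain P1 where P1: "P1 \<in> countable_partitions H A"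
      "\<And>\<alpha> x y. \<alpha> \<in> P1 \<Longrightarrow> \<not> \<alpha> \<subseteq> N \<Longrightarrow> x \<in> \<alpha> \<Longrightarrow> y \<in> \<alpha> \<Longrightarrow> \<bar>f x - f y\<bar> \<le> 1"
      using oscillation_partition[OF A, of 1] by auto
    show "\<exists>P1\<in>countable_partitions H A. \<forall>P\<in>countable_partitions H A. \<forall>\<delta>.
        refines A P P1 \<and> choice_function \<Omega> \<delta> \<longrightarrow> (\<lambda>\<alpha>. f (\<delta> \<alpha>) *\<^sub>R \<mu> \<alpha>) summable_on P"
    proof (rule bexI[OF _ P1(1)], intro ballI allI impI, elim conjE)
      fix P \<delta> assume P: "P \<in> countable_partitions H A" "refines A P P1" and \<delta>: "choice_function \<Omega> \<delta>"
      show "(\<lambda>\<alpha>. f (\<delta> \<alpha>) *\<^sub>R \<mu> \<alpha>) summable_on P"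
        by (rule summable[OF refined_choice_near[OF P1(2) P \<delta>] P(1)])
    qed
  next
    fix U :: "'x set" assume U: "open U" "0 \<in> U"
    obtain V where V: "open V" "0 \<in> V" "closure V \<subseteq> U"
      using zero_neighbourhood_arith[OF U] by metis
    obtain \<eta> :: real where \<eta>: "\<eta> > 0"
      "\<forall>K c. finite K \<and> K \<subseteq> H \<and> disjoint K \<and> (\<forall>\<alpha>\<in>K. \<forall>x\<in>\<alpha> - N. \<bar>f x - c \<alpha>\<bar> \<le> \<eta>) \<longrightarrow>
        (\<Sum>\<alpha>\<in>K. c \<alpha> *\<^sub>R \<mu> \<alpha>) - sum \<nu> K \<in> V"
      using partition_sums_near_integral[OF V(1,2)] by (elim exE conjE)
    obtain P0 where P0: "P0 \<in> countable_partitions H A"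
      "\<And>\<alpha> x y. \<alpha> \<in> P0 \<Longrightarrow> \<not> \<alpha> \<subseteq> N \<Longrightarrow> x \<in> \<alpha> \<Longrightarrow> y \<in> \<alpha> \<Longrightarrow> \<bar>f x - f y\<bar> \<le> \<eta>"
      using oscillation_partition[OF A \<eta>(1)] by auto
    show "\<exists>P0\<in>countable_partitions H A. \<forall>P\<in>countable_partitions H A. \<forall>\<delta>.
        refines A P P0 \<and> choice_function \<Omega> \<delta> \<longrightarrow> (\<Sum>\<^sub>\<infinity>\<alpha>\<in>P. f (\<delta> \<alpha>) *\<^sub>R \<mu> \<alpha>) - \<nu> A \<in> U"
    proof (rule bexI[OF _ P0(1)], intro ballI allI impI, elim conjE)
      fix P \<delta> assume P: "P \<in> countable_partitions H A" "refines A P P0" and \<delta>: "choice_function \<Omega> \<delta>"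
      note near = refined_choice_near[OF P0(2) P \<delta>]
      note PD = countable_partitionsD[OF P(1)]
      have "((\<lambda>\<alpha>. f (\<delta> \<alpha>) *\<^sub>R \<mu> \<alpha>) has_sum (\<Sum>\<^sub>\<infinity>\<alpha>\<in>P. f (\<delta> \<alpha>) *\<^sub>R \<mu> \<alpha>)) P"
        by (rule has_sum_infsum[OF summable[OF near P(1)]])
      moreover have "(\<nu> has_sum \<nu> A) P" using vector_measure_has_sum[OF integral_vector_measure PD(1-3)] PD(4)
        by simp
      ultimately have lim: "((\<lambda>K. (\<Sum>\<alpha>\<in>K. f (\<delta> \<alpha>) *\<^sub>R \<mu> \<alpha>) - sum \<nu> K) \<longlongrightarrow>
          (\<Sum>\<^sub>\<infinity>\<alpha>\<in>P. f (\<delta> \<alpha>) *\<^sub>R \<mu> \<alpha>) - \<nu> A) (finite_subsets_at_top P)"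
        unfolding has_sum_def by (rule tendsto_diff)
      have "\<forall>\<^sub>F K in finite_subsets_at_top P. (\<Sum>\<alpha>\<in>K. f (\<delta> \<alpha>) *\<^sub>R \<mu> \<alpha>) - sum \<nu> K \<in> closure V"
      proof (rule eventually_finite_subsets_at_top_weakI)
        fix K assume K: "finite K" "K \<subseteq> P"
        have "(\<Sum>\<alpha>\<in>K. f (\<delta> \<alpha>) *\<^sub>R \<mu> \<alpha>) - sum \<nu> K \<in> V"
        proof (intro \<eta>(2)[rule_format, of K "\<lambda>\<alpha>. f (\<delta> \<alpha>)"] conjI ballI K(1))
          show "K \<subseteq> H" "disjoint K" using K(2) PD(2) pairwise_subset[OF PD(3) K(2)] by auto
          fix \<alpha> x assume "\<alpha> \<in> K" "x \<in> \<alpha> - N"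
          then show "\<bar>f x - f (\<delta> \<alpha>)\<bar> \<le> \<eta>" using K(2) by (intro near) auto
        qed
        then show "(\<Sum>\<alpha>\<in>K. f (\<delta> \<alpha>) *\<^sub>R \<mu> \<alpha>) - sum \<nu> K \<in> closure V"
          by (rule subsetD[OF closure_subset])
      qed
      then have "(\<Sum>\<^sub>\<infinity>\<alpha>\<in>P. f (\<delta> \<alpha>) *\<^sub>R \<mu> \<alpha>) - \<nu> A \<in> closure V"
        by (intro Lim_in_closed_set[OF closed_closure _ _ lim]) simp_all
      then show "(\<Sum>\<^sub>\<infinity>\<alpha>\<in>P. f (\<delta> \<alpha>) *\<^sub>R \<mu> \<alpha>) - \<nu> A \<in> U" by (rule subsetD[OF V(3)])
    qed
  }
qed

end


section \<open>The two integrals agree\<close>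

theorem theorem5p4:
  fixes \<Omega> :: "'a set" and H :: "'a set set"
    and \<mu> :: "'a set \<Rightarrow> 'x::hausdorff_tvs" and f :: "'a \<Rightarrow> real"
  assumes "sequentially_complete TYPE('x)"
    and "\<Omega> \<noteq> {}" and "sigma_algebra \<Omega> H"
    and "vector_measure H \<mu>" and "convexly_bounded H \<mu>"
    and "bds_integrable \<Omega> H \<mu> f"
  shows "sstar_integrable \<Omega> H \<mu> f \<and>
    (\<forall>A\<in>H. \<forall>z. has_bds_integral \<Omega> H \<mu> A f z \<longrightarrow> has_sstar_integral \<Omega> H \<mu> A f z)"
proof -
  have main: "has_sstar_integral \<Omega> H \<mu> A f (lim (\<lambda>n. vm_simple_integral \<Omega> \<mu> A (s n)))"
    if s: "bds_sequence \<Omega> H \<mu> f s" and A: "A \<in> H" for s A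
  proof -
    obtain N where "vm_null H \<mu> N" "\<forall>x\<in>\<Omega> - N. (\<lambda>n. s n x) \<longlonglongrightarrow> f x"
      using s unfolding bds_sequence_def vm_ae_def by blast
    moreover have "(\<lambda>n. vm_simple_integral \<Omega> \<mu> B (s n)) \<longlonglongrightarrow>
        lim (\<lambda>n. vm_simple_integral \<Omega> \<mu> B (s n))" if "B \<in> H" for B
      using s that unfolding bds_sequence_def by (simp add: convergent_LIMSEQ_iff)
    ultimately interpret bds_approximation \<Omega> H \<mu> f s N
      "\<lambda>B. lim (\<lambda>n. vm_simple_integral \<Omega> \<mu> B (s n))"
      using s assms(3-5) unfolding bds_approximation_def bds_approximation_axioms_def bds_sequence_def
      by blast
    show ?thesis using assms(1) A by (rule has_sstar_integral_limit)
  qed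
  have "has_sstar_integral \<Omega> H \<mu> A f z" if A: "A \<in> H" and z: "has_bds_integral \<Omega> H \<mu> A f z" for A z
  proof -
    obtain s where "bds_sequence \<Omega> H \<mu> f s" "(\<lambda>n. vm_simple_integral \<Omega> \<mu> A (s n)) \<longlonglongrightarrow> z"
      using z unfolding has_bds_integral_def by blast
    then show ?thesis using main[of s A] A limI by metis
  qed
  moreover have "sstar_integrable \<Omega> H \<mu> f"
    using assms(6) main unfolding bds_integrable_def sstar_integrable_def by blast
  ultimately show ?thesis by blast
qed

end
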